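(* Let $\lambda,\mu,\nu\in\mathbb{R}$ be pairwise distinct and $\mathfrak{p}=\{(\lambda,1),(\mu,3),(\nu,3)\}$. A cross-section for $\mathrm{Sym}_{\mathfrak{p}}/\mathcal{G}_2$ is given by the set of all block diagonal matrices $$\operatorname{diag}(\mu\mathbb{I}_2,A,\nu,B),\qquad A=R_\alpha^{-1}\begin{pmatrix}\mu&0\\0&\nu\end{pmatrix}R_\alpha,\quad B=R_\theta^{-1}\begin{pmatrix}\nu&0\\0&\lambda\end{pmatrix}R_\theta,$$ with $(\alpha,\theta)\in\left(\left]0,\frac{\pi}{2}\right]\times\left[0,\frac{\pi}{2}\right]\right)\cup\{(0,0)\}$.
   Context: $R_\alpha=\begin{pmatrix}\cos\alpha&-\sin\alpha\\ \sin\alpha&\cos\alpha\end{pmatrix}$; $\operatorname{diag}(\cdot)$ denotes the block diagonal matrix with the listed blocks; $]a,b]$ denotes a half-open interval. Let $V$ be a 7-dimensional Euclidean space with a vector product $\pi$, i.e. a linear map $\pi:V\wedge V\to V$ such that $\{u,v,\pi(u\wedge v)\}$ is orthonormal whenever $\{u,v\}\subset V$ is. Write $xy=\pi(x\wedge y)$. Let $\mathcal{G}_2=\mathrm{Aut}(\pi)$ be the group of all orthogonal linear maps $g:V\to V$ with $g(xy)=g(x)g(y)$ for all $x,y\in V$. A Cayley triple is a triple $(u,v,z)\in V^3$ such that $\{u,v,uv,z\}$ is orthonormal; it determines an orthonormal basis $(u,v,uv,z,uz,vz,(uv)z)$ of $V$. Fix a Cayley triple $s$, and for a symmetric endomorphism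 $\delta$ of $V$ let $[\delta]_s$ be its matrix in the basis determined by $s$; $\delta\mapsto[\delta]_s$ is a bijection $\mathrm{Sym}(V)\to\mathrm{Sym}(\mathbb{R}^7)$ from symmetric endomorphisms of $V$ to real symmetric $7\times7$-matrices. $\mathcal{G}_2$ acts on $\mathrm{Sym}(\mathbb{R}^7)$ by $[\delta]_s\cdot g=[g^{-1}\delta g]_s$. For a symmetric matrix $\delta$ let $\mathfrak{p}(\delta)=\{(\lambda,\dim\mathcal{E}_\lambda(\delta))\mid\lambda\text{ an eigenvalue of }\delta\}$, where $\mathcal{E}_\lambda(\delta)$ is the eigenspace of $\lambda$, and for a set $\mathfrak{p}$ of such pairs let $\mathrm{Sym}_{\mathfrak{p}}=\{\delta\in\mathrm{Sym}(\mathbb{R}^7)\mid\mathfrak{p}(\delta)=\mathfrak{p}\}$, which is invariant under the action. A cross-section for $\mathrm{Sym}_{\mathfrak{p}}/\mathcal{G}_2$ is a subset of $\mathrm{Sym}_{\mathfrak{p}}$ containing exactly one element of each $\mathcal{G}_2$-orbit. $\mathbb{I}_n$ is the $n\times n$ identity matrix. *)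

theory Defs
  imports "HOL-Analysis.Analysis"
begin

definition orthonormal :: "'a::real_inner list \<Rightarrow> bool" where
  "orthonormal xs \<longleftrightarrow> (\<forall>x\<in>set xs. norm x = 1) \<and> sorted_wrt orthogonal xs"

text \<open>A linear map \<open>V \<and> V \<rightarrow> V\<close> is encoded as the corresponding alternating bilinear map;
  \<open>\<pi> x y\<close> stands for \<open>\<pi>(x \<and> y) = xy\<close>.\<close>

definition vector_product :: "('a::euclidean_space \<Rightarrow> 'a \<Rightarrow> 'a) \<Rightarrow> bool" where
  "vector_product \<pi> \<longleftrightarrow>
     bilinear \<pi> \<and> (\<forall>x. \<pi> x x = 0) \<and>
     (\<forall>u v. orthonormal [u, v] \<longrightarrow> orthonormal [u, v, \<pi> u v])"

definition G2 :: "('a::euclidean_space \<Rightarrow> 'a \<Rightarrow> 'a) \<Rightarrow> ('a \<Rightarrow> 'a) set" where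
  "G2 \<pi> = {g. orthogonal_transformation g \<and> (\<forall>x y. g (\<pi> x y) = \<pi> (g x) (g y))}"

fun cayley_triple :: "('a::euclidean_space \<Rightarrow> 'a \<Rightarrow> 'a) \<Rightarrow> 'a \<times> 'a \<times> 'a \<Rightarrow> bool" where
  "cayley_triple \<pi> (u, v, z) \<longleftrightarrow> orthonormal [u, v, \<pi> u v, z]"

text \<open>Components of a vector in \<open>'b ^ 7\<close> are numbered \<open>1, \<dots>, 7\<close>, as in \<^const>\<open>vector\<close>
  (in the index type, \<open>7 = 0\<close>).\<close>

fun cayley_basis :: "('a::euclidean_space \<Rightarrow> 'a \<Rightarrow> 'a) \<Rightarrow> 'a \<times> 'a \<times> 'a \<Rightarrow> 'a ^ 7" where
  "cayley_basis \<pi> (u, v, z) =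
     vector [u, v, \<pi> u v, z, \<pi> u z, \<pi> v z, \<pi> (\<pi> u v) z]"

definition symmetric_endos :: "('a::euclidean_space \<Rightarrow> 'a) set" where
  "symmetric_endos = {\<delta>. linear \<delta> \<and> (\<forall>x y. \<delta> x \<bullet> y = x \<bullet> \<delta> y)}"

definition symmetric_matrices :: "(real ^ 'n ^ 'n) set" where
  "symmetric_matrices = {M. transpose M = M}"

text \<open>The matrix \<open>[\<delta>]\<^sub>s\<close>. As the basis is orthonormal, the coordinate of
  \<open>\<delta> b\<^sub>j\<close> along \<open>b\<^sub>i\<close> is an inner product.\<close>

definition matrix_wrt ::
  "('a::euclidean_space \<Rightarrow> 'a \<Rightarrow> 'a) \<Rightarrow> 'a \<times> 'a \<times> 'a \<Rightarrow> ('a \<Rightarrow> 'a) \<Rightarrow> real ^ 7 ^ 7" where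
  "matrix_wrt \<pi> s \<delta> = (\<chi> i j. cayley_basis \<pi> s $ i \<bullet> \<delta> (cayley_basis \<pi> s $ j))"

text \<open>For a Cayley triple \<open>s\<close>, \<^const>\<open>matrix_wrt\<close> is a bijection from
  \<^const>\<open>symmetric_endos\<close> onto \<^const>\<open>symmetric_matrices\<close>; the action is
  \<open>[\<delta>]\<^sub>s \<cdot> g = [g\<^sup>-\<^sup>1 \<delta> g]\<^sub>s\<close> for symmetric \<open>\<delta>\<close>.\<close>

definition endo_of ::
  "('a::euclidean_space \<Rightarrow> 'a \<Rightarrow> 'a) \<Rightarrow> 'a \<times> 'a \<times> 'a \<Rightarrow> real ^ 7 ^ 7 \<Rightarrow> 'a \<Rightarrow> 'a" where
  "endo_of \<pi> s = the_inv_into symmetric_endos (matrix_wrt \<pi> s)"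

definition act ::
  "('a::euclidean_space \<Rightarrow> 'a \<Rightarrow> 'a) \<Rightarrow> 'a \<times> 'a \<times> 'a \<Rightarrow> real ^ 7 ^ 7 \<Rightarrow> ('a \<Rightarrow> 'a) \<Rightarrow> real ^ 7 ^ 7" where
  "act \<pi> s M g = matrix_wrt \<pi> s (inv g \<circ> endo_of \<pi> s M \<circ> g)"

definition orbit ::
  "('a::euclidean_space \<Rightarrow> 'a \<Rightarrow> 'a) \<Rightarrow> 'a \<times> 'a \<times> 'a \<Rightarrow> real ^ 7 ^ 7 \<Rightarrow> (real ^ 7 ^ 7) set" where
  "orbit \<pi> s M = act \<pi> s M ` G2 \<pi>"

definition cross_section ::
  "('a::euclidean_space \<Rightarrow> 'a \<Rightarrow> 'a) \<Rightarrow> 'a \<times> 'a \<times> 'a \<Rightarrow>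
    (real ^ 7 ^ 7) set \<Rightarrow> (real ^ 7 ^ 7) set \<Rightarrow> bool" where
  "cross_section \<pi> s X C \<longleftrightarrow> C \<subseteq> X \<and> (\<forall>Orb \<in> orbit \<pi> s ` X. \<exists>!N. N \<in> C \<and> N \<in> Orb)"

definition eigenspace :: "real ^ 'n ^ 'n \<Rightarrow> real \<Rightarrow> (real ^ 'n) set" where
  "eigenspace M a = {x. M *v x = a *\<^sub>R x}"

definition eigenvalue :: "real ^ 'n ^ 'n \<Rightarrow> real \<Rightarrow> bool" where
  "eigenvalue M a \<longleftrightarrow> (\<exists>x. x \<noteq> 0 \<and> M *v x = a *\<^sub>R x)"

definition eigenvalue_pairs :: "real ^ 'n ^ 'n \<Rightarrow> (real \<times> nat) set" where
  "eigenvalue_pairs M = {(a, dim (eigenspace M a)) | a. eigenvalue M a}"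

definition Sym_with :: "(real \<times> nat) set \<Rightarrow> (real ^ 7 ^ 7) set" where
  "Sym_with \<pp> = {M \<in> symmetric_matrices. eigenvalue_pairs M = \<pp>}"

definition rotation :: "real \<Rightarrow> real ^ 2 ^ 2" where
  "rotation \<alpha> = vector [vector [cos \<alpha>, - sin \<alpha>], vector [sin \<alpha>, cos \<alpha>]]"

definition rotated_diag :: "real \<Rightarrow> real \<Rightarrow> real \<Rightarrow> real ^ 2 ^ 2" where
  "rotated_diag \<alpha> a b =
     matrix_inv (rotation \<alpha>) ** vector [vector [a, 0], vector [0, b]] ** rotation \<alpha>"

definition block_diag ::
  "real ^ 2 ^ 2 \<Rightarrow> real ^ 2 ^ 2 \<Rightarrow> real \<Rightarrow> real ^ 2 ^ 2 \<Rightarrow> real ^ 7 ^ 7" where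
  "block_diag C A c B = vector
    [vector [C $ 1 $ 1, C $ 1 $ 2, 0, 0, 0, 0, 0],
     vector [C $ 2 $ 1, C $ 2 $ 2, 0, 0, 0, 0, 0],
     vector [0, 0, A $ 1 $ 1, A $ 1 $ 2, 0, 0, 0],
     vector [0, 0, A $ 2 $ 1, A $ 2 $ 2, 0, 0, 0],
     vector [0, 0, 0, 0, c, 0, 0],
     vector [0, 0, 0, 0, 0, B $ 1 $ 1, B $ 1 $ 2],
     vector [0, 0, 0, 0, 0, B $ 2 $ 1, B $ 2 $ 2]]"

end

theory Submission
  imports Defs
begin

text \<open>An element of \<open>G2\<close> carries Cayley triples to Cayley triples, and it does so transitively, because the
  multiplication table of a Cayley basis is the same for every triple (\<open>cayley_products\<close>, \<open>G2_transitive\<close>).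
  The orbit of a matrix \<open>M\<close> is therefore the set of matrices of one and the same symmetric endomorphism \<open>\<delta>\<close> in all
  Cayley bases (\<open>orbit_eq_matrix_wrt\<close>). In the basis of \<open>(u, v, z)\<close> this matrix has the normal form with
  angles \<open>\<alpha>\<close>, \<open>\<theta>\<close> exactly if the \<open>\<mu>\<close>-eigenspace \<open>W\<close> is spanned by \<open>u\<close>, \<open>v\<close> and
  \<open>cos \<alpha> uv - sin \<alpha> z\<close>, and the \<open>lam\<close>-eigenspace by \<open>sin \<theta> vz + cos \<theta> (uv)z\<close>; the
  \<open>\<nu>\<close>-eigenspace is then the orthogonal complement (\<open>normal_form_eigenframe_iff\<close>,
  \<open>eigenframe_complete\<close>). So the theorem classifies pairs of a three-dimensional space \<open>W\<close> and a line orthogonal to it,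
  spanned by a unit vector \<open>l\<close>.

  The angles are determined by \<open>\<delta>\<close> (\<open>angles_unique\<close>). Two orthonormal bases of \<open>W\<close> differ by a
  determinant \<open>\<plusminus>1\<close>, so the absolute value of an alternating trilinear form on such a basis depends on \<open>W\<close> alone. The
  associative form \<open>xy \<bullet> w\<close> yields \<open>cos \<alpha>\<close>, and the coassociative form
  \<open>(x(yw) + (x \<bullet> y) w - (x \<bullet> w) y) \<bullet> l\<close> yields \<open>sin \<alpha> cos \<theta>\<close>. For angles between \<open>0\<close> and \<open>pi / 2\<close>
  this recovers \<open>\<alpha>\<close>, and also \<open>\<theta>\<close> if \<open>\<alpha> > 0\<close>. For \<open>\<alpha> = 0\<close> the space \<open>W\<close> is closed under the product and all
  lines orthogonal to it are equivalent, which is why only \<open>\<theta> = 0\<close> is admitted there.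

  A suitable Cayley triple exists for every pair (\<open>normal_position\<close>). For \<open>\<alpha> = 0\<close> any orthonormal \<open>u\<close>, \<open>v\<close> in
  \<open>W\<close> can be completed by solving \<open>(uv)z = l\<close>. For \<open>\<alpha> > 0\<close> the coassociative form distinguishes a
  unit vector \<open>c\<close> orthogonal to \<open>W\<close>, which has to equal \<open>(uv)z\<close>; the component of \<open>l\<close> orthogonal to \<open>c\<close> has to
  point in the direction of \<open>vz = uc\<close>. Right multiplication by \<open>c\<close> maps \<open>W\<close> bijectively onto the vectors
  orthogonal to \<open>W\<close> and \<open>c\<close>, so \<open>u\<close> can be found in \<open>W\<close>; then \<open>v\<close> is any unit vector of \<open>W\<close> orthogonal to \<open>u\<close>,
  and \<open>z\<close> is given by the oriented completion of \<open>u\<close>, \<open>v\<close> to an orthonormal basis of \<open>W\<close>.\<close>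

section \<open>Orthonormal frames\<close>

lemma exhaust_7: "x = 1 \<or> x = 2 \<or> x = 3 \<or> x = 4 \<or> x = 5 \<or> x = 6 \<or> x = 7" for x :: 7
proof (induct x)
  case (of_int z)
  then have "z = 0 \<or> z = 1 \<or> z = 2 \<or> z = 3 \<or> z = 4 \<or> z = 5 \<or> z = 6" by fastforce
  then show ?case by auto
qed

lemma forall_7: "(\<forall>i::7. P i) \<longleftrightarrow> P 1 \<and> P 2 \<and> P 3 \<and> P 4 \<and> P 5 \<and> P 6 \<and> P 7"
  by (metis exhaust_7)

lemma UNIV_7: "UNIV = {1, 2, 3, 4, 5, 6, 7::7}"
  using exhaust_7 by auto

lemma sum_7: "sum f (UNIV::7 set) = f 1 + f 2 + f 3 + f 4 + f 5 + f 6 + f 7"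
  unfolding UNIV_7 by (simp add: ac_simps)

lemma vector_7 [simp]:
  "(vector [a,b,c,d,e,f,g] :: 'b::zero^7) $ 1 = a"
  "(vector [a,b,c,d,e,f,g] :: 'b::zero^7) $ 2 = b"
  "(vector [a,b,c,d,e,f,g] :: 'b::zero^7) $ 3 = c"
  "(vector [a,b,c,d,e,f,g] :: 'b::zero^7) $ 4 = d"
  "(vector [a,b,c,d,e,f,g] :: 'b::zero^7) $ 5 = e"
  "(vector [a,b,c,d,e,f,g] :: 'b::zero^7) $ 6 = f"
  "(vector [a,b,c,d,e,f,g] :: 'b::zero^7) $ 7 = g"
  unfolding vector_def by simp_all

definition orthonormal_frame :: "'a::real_inner ^ 'n \<Rightarrow> bool" where
  "orthonormal_frame b \<longleftrightarrow> (\<forall>i j. b $ i \<bullet> b $ j = (if i = j then 1 else 0))"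

lemma orthonormal_frameD:
  "orthonormal_frame b \<Longrightarrow> b $ i \<bullet> b $ j = (if i = j then 1 else 0)"
  by (simp add: orthonormal_frame_def)

lemma orthonormal_frame_7:
  fixes b :: "'a::real_inner ^ 7"
  assumes "b$1 \<bullet> b$1 = 1" "b$2 \<bullet> b$2 = 1" "b$3 \<bullet> b$3 = 1" "b$4 \<bullet> b$4 = 1"
    "b$5 \<bullet> b$5 = 1" "b$6 \<bullet> b$6 = 1" "b$7 \<bullet> b$7 = 1"
    "b$1 \<bullet> b$2 = 0" "b$1 \<bullet> b$3 = 0" "b$1 \<bullet> b$4 = 0" "b$1 \<bullet> b$5 = 0" "b$1 \<bullet> b$6 = 0" "b$1 \<bullet> b$7 = 0"
    "b$2 \<bullet> b$3 = 0" "b$2 \<bullet> b$4 = 0" "b$2 \<bullet> b$5 = 0" "b$2 \<bullet> b$6 = 0" "b$2 \<bullet> b$7 = 0"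
    "b$3 \<bullet> b$4 = 0" "b$3 \<bullet> b$5 = 0" "b$3 \<bullet> b$6 = 0" "b$3 \<bullet> b$7 = 0"
    "b$4 \<bullet> b$5 = 0" "b$4 \<bullet> b$6 = 0" "b$4 \<bullet> b$7 = 0"
    "b$5 \<bullet> b$6 = 0" "b$5 \<bullet> b$7 = 0" "b$6 \<bullet> b$7 = 0"
  shows "orthonormal_frame b"
  unfolding orthonormal_frame_def forall_7 using assms by (simp add: inner_commute)

lemma frame_inj:
  assumes "orthonormal_frame b"
  shows "inj (($) b)"
  using assms unfolding orthonormal_frame_def inj_def by (metis zero_neq_one)

lemma frame_independent:
  assumes "orthonormal_frame b"
  shows "independent (($) b ` I)"
proof (rule pairwise_orthogonal_independent)
  show "pairwise orthogonal (($) b ` I)"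
    using assms by (auto simp: pairwise_def orthogonal_def orthonormal_frame_def)
  show "0 \<notin> ($) b ` I"
    using assms by (auto simp: orthonormal_frame_def) (metis inner_zero_left zero_neq_one)
qed

text \<open>Independence makes a frame of the right length spanning, so Fourier expansion is exact.\<close>

lemma frame_span:
  fixes b :: "'a::euclidean_space ^ 'n"
  assumes "orthonormal_frame b" "DIM('a) = CARD('n)"
  shows "span (range (($) b)) = UNIV"
proof -
  have "card (range (($) b)) = DIM('a)"
    using frame_inj[OF assms(1)] assms(2) by (simp add: card_image)
  then have "UNIV \<subseteq> span (range (($) b))"
    using frame_independent[OF assms(1), of UNIV]
    by (intro card_ge_dim_independent) auto
  then show ?thesis by blast
qed

lemma frame_expand:
  fixes b :: "'a::euclidean_space ^ 'n"
  assumes "orthonormal_frame b" "DIM('a) = CARD('n)"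
  shows "(\<Sum>i\<in>UNIV. (x \<bullet> b $ i) *\<^sub>R b $ i) = x"
proof -
  have "(\<Sum>i\<in>UNIV. (x \<bullet> b $ i) *\<^sub>R b $ i) = (\<Sum>v\<in>range (($) b). (x \<bullet> v) *\<^sub>R v)"
    using frame_inj[OF assms(1)] by (simp add: sum.reindex)
  also have "\<dots> = x"
    using assms(1) frame_span[OF assms]
    by (intro orthonormal_basis_expand)
       (auto simp: pairwise_def orthogonal_def orthonormal_frame_def norm_eq_1)
  finally show ?thesis .
qed

lemma frame_ext:
  fixes b :: "'a::euclidean_space ^ 'n"
  assumes "orthonormal_frame b" "DIM('a) = CARD('n)" "\<And>i. x \<bullet> b $ i = y \<bullet> b $ i"
  shows "x = y"
  by (subst (1 2) frame_expand[OF assms(1,2), symmetric]) (simp only: assms(3))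

lemma orthogonal_transformation_of_frames:
  fixes b b' :: "'a::euclidean_space ^ 'n"
  assumes b: "orthonormal_frame b" and b': "orthonormal_frame b'" and DIM: "DIM('a) = CARD('n)"
  obtains g where "orthogonal_transformation g" "\<And>i. g (b$i) = b'$i"
proof
  define g where "g x = (\<Sum>i\<in>UNIV. (x \<bullet> b$i) *\<^sub>R b'$i)" for x
  have lin: "linear g"
    by (rule linearI)
       (simp_all add: g_def inner_left_distrib scaleR_left_distrib sum.distrib scaleR_sum_right)
  have "g x \<bullet> g y = x \<bullet> y" for x y
  proof -
    have "g x \<bullet> g y = (\<Sum>i\<in>UNIV. (x \<bullet> b$i) * (y \<bullet> b$i))"
      by (simp add: g_def inner_sum_left inner_sum_right orthonormal_frameD[OF b']
          if_distrib mult.commute cong: if_cong)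
    also have "\<dots> = (\<Sum>i\<in>UNIV. (x \<bullet> b$i) *\<^sub>R b$i) \<bullet> y"
      by (simp add: inner_sum_left inner_commute[of "b $ _" y])
    finally show ?thesis by (simp only: frame_expand[OF b DIM])
  qed
  then show "orthogonal_transformation g"
    using lin by (simp add: orthogonal_transformation_def)
  show "g (b$i) = b'$i" for i
    by (simp add: g_def orthonormal_frameD[OF b] if_distrib[of "\<lambda>c. c *\<^sub>R _"] cong: if_cong)
qed

section \<open>Eigenframes and multiplicities\<close>

text \<open>The eigenvalues are listed in a fixed order, so that eigenspaces can be addressed by index sets.\<close>

definition eigenframe :: "('a::real_inner \<Rightarrow> 'a) \<Rightarrow> real ^ 'n \<Rightarrow> 'a ^ 'n \<Rightarrow> bool" where
  "eigenframe \<delta> \<epsilon> d \<longleftrightarrow>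
     orthonormal_frame d \<and> (\<forall>k. \<delta> (d $ k) = (\<epsilon> $ k) *\<^sub>R d $ k)"

lemma eigenframe_inner:
  fixes d :: "'a::euclidean_space ^ 'n"
  assumes "eigenframe \<delta> \<epsilon> d" "linear \<delta>" "DIM('a) = CARD('n)"
  shows "\<delta> x \<bullet> d $ k = \<epsilon> $ k * (x \<bullet> d $ k)"
proof -
  have on: "orthonormal_frame d" and ev: "\<And>k. \<delta> (d $ k) = (\<epsilon> $ k) *\<^sub>R d $ k"
    using assms(1) by (auto simp: eigenframe_def)
  have "\<delta> x = \<delta> (\<Sum>i\<in>UNIV. (x \<bullet> d $ i) *\<^sub>R d $ i)"
    by (simp only: frame_expand[OF on assms(3)])
  also have "\<dots> = (\<Sum>i\<in>UNIV. (x \<bullet> d $ i) *\<^sub>R (\<epsilon> $ i) *\<^sub>R d $ i)"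
    by (simp add: linear_sum[OF assms(2)] linear_scale[OF assms(2)] ev)
  finally show ?thesis
    by (simp add: inner_sum_left orthonormal_frameD[OF on] if_distrib cong: if_cong)
qed

text \<open>In the coordinates of an eigenframe, \<open>\<delta>\<close> multiplies the \<open>k\<close>-th coordinate by \<open>\<epsilon> $ k\<close>, so an
  eigenvector for \<open>a\<close> cannot have a coordinate where \<open>\<epsilon> $ k\<close> differs from \<open>a\<close>.\<close>

lemma eigenframe_eigenvector_iff:
  fixes d :: "'a::euclidean_space ^ 'n"
  assumes "eigenframe \<delta> \<epsilon> d" "linear \<delta>" "DIM('a) = CARD('n)"
  shows "\<delta> x = a *\<^sub>R x \<longleftrightarrow> (\<forall>k. \<epsilon> $ k \<noteq> a \<longrightarrow> x \<bullet> d $ k = 0)"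
proof -
  have on: "orthonormal_frame d" using assms(1) by (simp add: eigenframe_def)
  have "\<delta> x = a *\<^sub>R x \<longleftrightarrow> (\<forall>k. \<delta> x \<bullet> d $ k = (a *\<^sub>R x) \<bullet> d $ k)"
    using frame_ext[OF on assms(3)] by metis
  then show ?thesis using eigenframe_inner[OF assms] by auto
qed

lemma eigenframe_eigenspace:
  fixes d :: "'a::euclidean_space ^ 'n"
  assumes "eigenframe \<delta> \<epsilon> d" "linear \<delta>" "DIM('a) = CARD('n)"
  shows "{x. \<delta> x = a *\<^sub>R x} = span (($) d ` {k. \<epsilon> $ k = a})"
proof (intro set_eqI iffI)
  have on: "orthonormal_frame d" using assms(1) by (simp add: eigenframe_def)
  fix x
  show "x \<in> span (($) d ` {k. \<epsilon> $ k = a})" if "x \<in> {x. \<delta> x = a *\<^sub>R x}"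
  proof -
    have *: "x \<bullet> d $ k = 0" if "\<epsilon> $ k \<noteq> a" for k
      using \<open>x \<in> _\<close> that eigenframe_eigenvector_iff[OF assms] by blast
    have "(\<Sum>i\<in>UNIV. (x \<bullet> d $ i) *\<^sub>R d $ i) \<in> span (($) d ` {k. \<epsilon> $ k = a})"
    proof (intro span_sum)
      show "(x \<bullet> d $ i) *\<^sub>R d $ i \<in> span (($) d ` {k. \<epsilon> $ k = a})" for i
        by (cases "\<epsilon> $ i = a") (auto simp: * span_zero intro: span_scale span_base)
    qed
    then show ?thesis by (simp only: frame_expand[OF on assms(3)])
  qed
  show "x \<in> {x. \<delta> x = a *\<^sub>R x}" if "x \<in> span (($) d ` {k. \<epsilon> $ k = a})"
    using that
  proof (induction rule: span_induct)
    case base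
    show ?case
      using assms(2) by (auto simp: subspace_def linear_add linear_scale linear_0 algebra_simps)
  next
    case (step x)
    then show ?case using assms(1) by (auto simp: eigenframe_def)
  qed
qed

text \<open>The frame vectors belonging to one eigenvalue form a basis of its eigenspace, so multiplicities
  can be counted on the list \<open>\<epsilon>\<close>.\<close>

lemma eigenframe_eigenvalue_pairs:
  fixes M :: "real ^ 'n ^ 'n" and \<epsilon> :: "real ^ 'n"
  assumes "eigenframe ((*v) M) \<epsilon> d"
  shows "eigenvalue_pairs M = (\<lambda>k. (\<epsilon> $ k, card {i. \<epsilon> $ i = \<epsilon> $ k})) ` UNIV"
proof -
  have on: "orthonormal_frame d" using assms by (simp add: eigenframe_def)
  have lin: "linear ((*v) M)" by simp
  have DIM: "DIM(real ^ 'n) = CARD('n)" by simp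
  have dim: "dim (eigenspace M a) = card {i. \<epsilon> $ i = a}" for a
  proof -
    have "dim (eigenspace M a) = card (($) d ` {k. \<epsilon> $ k = a})"
      unfolding eigenspace_def eigenframe_eigenspace[OF assms lin DIM]
      using dim_span_eq_card_independent[OF frame_independent[OF on]] .
    also have "\<dots> = card {k. \<epsilon> $ k = a}"
      by (rule card_image, rule inj_on_subset[OF frame_inj[OF on]]) simp
    finally show ?thesis .
  qed
  have nz: "d $ k \<noteq> 0" for k
    using orthonormal_frameD[OF on, of k k] by auto
  have ev: "eigenvalue M a \<longleftrightarrow> a \<in> range (($) \<epsilon>)" for a
  proof
    assume "eigenvalue M a"
    then obtain x where x: "x \<noteq> 0" "M *v x = a *\<^sub>R x" by (auto simp: eigenvalue_def)
    show "a \<in> range (($) \<epsilon>)"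
    proof (rule ccontr)
      assume "a \<notin> range (($) \<epsilon>)"
      then have "x \<bullet> d $ k = 0 \<bullet> d $ k" for k
        using eigenframe_eigenvector_iff[OF assms lin DIM, of x a] x(2) by auto
      then show False using frame_ext[OF on DIM, of x 0] x(1) by simp
    qed
  next
    assume "a \<in> range (($) \<epsilon>)"
    then show "eigenvalue M a"
      using assms nz unfolding eigenvalue_def eigenframe_def by blast
  qed
  show ?thesis unfolding eigenvalue_pairs_def dim ev by auto
qed

definition spectrum_7 :: "real \<Rightarrow> real \<Rightarrow> real \<Rightarrow> real ^ 7" where
  "spectrum_7 lam \<mu> \<nu> = vector [\<mu>, \<mu>, \<mu>, \<nu>, \<nu>, \<nu>, lam]"

lemma eigenvalue_pairs_spectrum_7:
  fixes M :: "real ^ 7 ^ 7"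
  assumes "eigenframe ((*v) M) (spectrum_7 lam \<mu> \<nu>) d"
    and "lam \<noteq> \<mu>" "lam \<noteq> \<nu>" "\<mu> \<noteq> \<nu>"
  shows "eigenvalue_pairs M = {(lam, 1), (\<mu>, 3), (\<nu>, 3)}"
proof -
  have "{i. spectrum_7 lam \<mu> \<nu> $ i = lam} = {7}"
    "{i. spectrum_7 lam \<mu> \<nu> $ i = \<mu>} = {1, 2, 3}"
    "{i. spectrum_7 lam \<mu> \<nu> $ i = \<nu>} = {4, 5, 6}"
    unfolding set_eq_iff forall_7 using assms(2-4) by (simp_all add: spectrum_7_def)
  then have "card {i. spectrum_7 lam \<mu> \<nu> $ i = lam} = 1"
    "card {i. spectrum_7 lam \<mu> \<nu> $ i = \<mu>} = 3"
    "card {i. spectrum_7 lam \<mu> \<nu> $ i = \<nu>} = 3"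
    by simp_all
  then show ?thesis
    unfolding eigenframe_eigenvalue_pairs[OF assms(1)] UNIV_7
    by (auto simp: spectrum_7_def)
qed

lemma symmetric_matrix_inner:
  assumes "M \<in> symmetric_matrices"
  shows "(M *v x) \<bullet> y = x \<bullet> (M *v y)"
proof -
  have "M *v x = transpose M *v x" using assms by (simp add: symmetric_matrices_def)
  then show ?thesis by (simp only: transpose_matrix_vector dot_lmul_matrix)
qed

text \<open>Converse of \<open>eigenvalue_pairs_spectrum_7\<close>: the dimensions prescribe the sizes of
  orthonormal bases of the three eigenspaces, and eigenspaces of a symmetric matrix are mutually
  orthogonal, so these bases together form a frame.\<close>

lemma Sym_with_eigenframe:
  assumes M: "M \<in> Sym_with {(lam, 1), (\<mu>, 3), (\<nu>, 3)}"
    and ne: "lam \<noteq> \<mu>" "lam \<noteq> \<nu>" "\<mu> \<noteq> \<nu>"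
  obtains d where "eigenframe ((*v) M) (spectrum_7 lam \<mu> \<nu>) d"
proof -
  have sym: "(M *v x) \<bullet> y = x \<bullet> (M *v y)" for x y
    using M by (intro symmetric_matrix_inner) (simp add: Sym_with_def)
  have pairs: "eigenvalue_pairs M = {(lam, 1), (\<mu>, 3), (\<nu>, 3)}"
    using M by (simp add: Sym_with_def)
  have "(lam, 1) \<in> eigenvalue_pairs M" "(\<mu>, 3) \<in> eigenvalue_pairs M" "(\<nu>, 3) \<in> eigenvalue_pairs M"
    by (simp_all add: pairs)
  then have dims: "dim (eigenspace M lam) = 1" "dim (eigenspace M \<mu>) = 3" "dim (eigenspace M \<nu>) = 3"
    unfolding eigenvalue_pairs_def by auto
  have sub: "subspace (eigenspace M a)" for a
    by (auto simp: subspace_def eigenspace_def matrix_vector_right_distrib matrix_vector_mult_scaleR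
        algebra_simps)
  have basis: "\<exists>B \<subseteq> eigenspace M a. pairwise orthogonal B \<and> (\<forall>x\<in>B. norm x = 1) \<and>
      card B = dim (eigenspace M a)" for a
    using orthonormal_basis_subspace[OF sub[of a]] by metis
  obtain L where L: "L \<subseteq> eigenspace M lam" "\<forall>x\<in>L. norm x = 1" "card L = 1"
    using basis[of lam] dims by auto
  obtain A where A: "A \<subseteq> eigenspace M \<mu>" "pairwise orthogonal A" "\<forall>x\<in>A. norm x = 1" "card A = 3"
    using basis[of \<mu>] dims by auto
  obtain B where B: "B \<subseteq> eigenspace M \<nu>" "pairwise orthogonal B" "\<forall>x\<in>B. norm x = 1" "card B = 3"
    using basis[of \<nu>] dims by auto
  obtain l where l: "L = {l}" using L(3) by (rule card_1_singletonE)
  obtain a1 a2 a3 where a: "A = {a1, a2, a3}" "a1 \<noteq> a2" "a2 \<noteq> a3" "a1 \<noteq> a3"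
    using A(4) card_3_iff by metis
  obtain b1 b2 b3 where b: "B = {b1, b2, b3}" "b1 \<noteq> b2" "b2 \<noteq> b3" "b1 \<noteq> b3"
    using B(4) card_3_iff by metis
  have ev: "M *v l = lam *\<^sub>R l" "M *v a1 = \<mu> *\<^sub>R a1" "M *v a2 = \<mu> *\<^sub>R a2" "M *v a3 = \<mu> *\<^sub>R a3"
    "M *v b1 = \<nu> *\<^sub>R b1" "M *v b2 = \<nu> *\<^sub>R b2" "M *v b3 = \<nu> *\<^sub>R b3"
    using L(1) A(1) B(1) unfolding l a(1) b(1) eigenspace_def by blast+
  have unit: "l \<bullet> l = 1" "a1 \<bullet> a1 = 1" "a2 \<bullet> a2 = 1" "a3 \<bullet> a3 = 1"
    "b1 \<bullet> b1 = 1" "b2 \<bullet> b2 = 1" "b3 \<bullet> b3 = 1"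
    using L(2) A(3) B(3) unfolding a(1) b(1) l norm_eq_1 by blast+
  have orth_A: "a1 \<bullet> a2 = 0" "a1 \<bullet> a3 = 0" "a2 \<bullet> a3 = 0"
    using A(2) a(2-4) unfolding a(1) by (simp_all add: pairwise_insert orthogonal_def)
  have orth_B: "b1 \<bullet> b2 = 0" "b1 \<bullet> b3 = 0" "b2 \<bullet> b3 = 0"
    using B(2) b(2-4) unfolding b(1) by (simp_all add: pairwise_insert orthogonal_def)
  have orth: "x \<bullet> y = 0" if "M *v x = p *\<^sub>R x" "M *v y = q *\<^sub>R y" "p \<noteq> q" for x y p q
  proof -
    have "p * (x \<bullet> y) = q * (x \<bullet> y)"
      using sym[of x y] unfolding that(1,2) by simp
    then show ?thesis using that(3) by simp
  qed
  have orth_AB: "x \<bullet> y = 0" if "x \<in> {a1, a2, a3}" "y \<in> {b1, b2, b3}" for x y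
    using that ev ne(3) by (intro orth[of x \<mu> y \<nu>]) auto
  have orth_l: "x \<bullet> l = 0" if "x \<in> {a1, a2, a3, b1, b2, b3}" for x
    using that orth[OF _ ev(1)] ev ne(1,2) by blast
  have "eigenframe ((*v) M) (spectrum_7 lam \<mu> \<nu>) (vector [a1, a2, a3, b1, b2, b3, l])"
    unfolding eigenframe_def
  proof
    show "orthonormal_frame (vector [a1, a2, a3, b1, b2, b3, l] :: (real^7)^7)"
      using unit orth_A orth_B orth_AB orth_l
      by (intro orthonormal_frame_7) (simp_all add: inner_commute)
    show "\<forall>k. M *v vector [a1, a2, a3, b1, b2, b3, l] $ k =
        spectrum_7 lam \<mu> \<nu> $ k *\<^sub>R vector [a1, a2, a3, b1, b2, b3, l] $ k"
      unfolding forall_7 by (simp add: ev spectrum_7_def)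
  qed
  then show ?thesis by (rule that)
qed

section \<open>Alternating trilinear maps on three-dimensional spaces\<close>

definition alternating3 ::
  "('a::real_vector \<Rightarrow> 'a \<Rightarrow> 'a \<Rightarrow> 'b::real_vector) \<Rightarrow> bool" where
  "alternating3 T \<longleftrightarrow>
     (\<forall>y w. linear (\<lambda>x. T x y w)) \<and> (\<forall>x w. linear (\<lambda>y. T x y w)) \<and> (\<forall>x y. linear (T x y)) \<and>
     (\<forall>x y. T x x y = 0 \<and> T x y x = 0 \<and> T x y y = 0)"

definition combination :: "'a::real_vector ^ 3 \<Rightarrow> real ^ 3 \<Rightarrow> 'a" where
  "combination e r = (r$1) *\<^sub>R e$1 + (r$2) *\<^sub>R e$2 + (r$3) *\<^sub>R e$3"

text \<open>On a three-dimensional space there is up to a factor only one alternating trilinear map,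
  the determinant. In coordinates the determinant is the scalar triple product.\<close>

lemma alternating3_combination:
  assumes "alternating3 T"
  shows "T (combination e r) (combination e s) (combination e t) =
    (cross3 r s \<bullet> t) *\<^sub>R T (e$1) (e$2) (e$3)"
proof -
  have lin: "\<And>y w. linear (\<lambda>x. T x y w)" "\<And>x w. linear (\<lambda>y. T x y w)" "\<And>x y. linear (T x y)"
    and alt: "\<And>x y. T x x y = 0" "\<And>x y. T x y x = 0" "\<And>x y. T x y y = 0"
    using assms by (auto simp: alternating3_def)
  note linear =
    linear_add[OF lin(1)] linear_add[OF lin(2)] linear_add[OF lin(3)]
    linear_scale[OF lin(1)] linear_scale[OF lin(2)] linear_scale[OF lin(3)]
  have swap12: "T y x w = - T x y w" for x y w
    using alt(1)[of "x + y" w] unfolding linear by (simp add: alt eq_neg_iff_add_eq_0)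
  have swap23: "T x w y = - T x y w" for x y w
    using alt(3)[of x "y + w"] unfolding linear by (simp add: alt eq_neg_iff_add_eq_0)
  have perm: "T (e$2) (e$1) (e$3) = - T (e$1) (e$2) (e$3)"
    "T (e$1) (e$3) (e$2) = - T (e$1) (e$2) (e$3)"
    "T (e$3) (e$1) (e$2) = T (e$1) (e$2) (e$3)"
    "T (e$2) (e$3) (e$1) = T (e$1) (e$2) (e$3)"
    "T (e$3) (e$2) (e$1) = - T (e$1) (e$2) (e$3)"
    using swap12[of "e$2" "e$1" "e$3"] swap23[of "e$1" "e$3" "e$2"]
      swap12[of "e$3" "e$1" "e$2"] swap23[of "e$2" "e$3" "e$1"]
      swap12[of "e$3" "e$2" "e$1"] by simp_all
  show ?thesis
    unfolding combination_def
    by (simp add: linear alt perm cross3_def inner_vec_def sum_3 algebra_simps)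
qed

lemma combination_inner:
  assumes "orthonormal_frame e"
  shows "combination e r \<bullet> combination e s = r \<bullet> s"
  using orthonormal_frameD[OF assms]
  by (simp add: combination_def inner_vec_def sum_3 inner_left_distrib inner_right_distrib)

text \<open>Hadamard's inequality for a determinant with unit rows.\<close>

lemma cross3_inner_le:
  assumes "norm r = 1" "norm s = 1" "norm t = 1"
  shows "\<bar>cross3 r s \<bullet> t\<bar> \<le> 1"
proof -
  have "(norm (cross3 r s))\<^sup>2 \<le> 1\<^sup>2"
    using norm_cross[of r s] assms by simp
  then have "norm (cross3 r s) \<le> 1" by (rule power2_le_imp_le) simp
  then show ?thesis
    using Cauchy_Schwarz_ineq2[of "cross3 r s" t] assms by simp
qed

section \<open>Eigenframes with multiplicities three, three and one\<close>

lemma eigenframe_mu_combination: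
  fixes d :: "'a::euclidean_space ^ 7"
  assumes "eigenframe \<delta> (spectrum_7 lam \<mu> \<nu>) d" "linear \<delta>" "DIM('a) = 7"
    and "lam \<noteq> \<mu>" "\<mu> \<noteq> \<nu>" "\<delta> x = \<mu> *\<^sub>R x"
  shows "x = combination (vector [d$1, d$2, d$3]) (vector [x \<bullet> d$1, x \<bullet> d$2, x \<bullet> d$3])"
proof -
  have DIM: "DIM('a) = CARD(7)" using assms(3) by simp
  have on: "orthonormal_frame d" using assms(1) by (simp add: eigenframe_def)
  have "x \<bullet> d$4 = 0" "x \<bullet> d$5 = 0" "x \<bullet> d$6 = 0" "x \<bullet> d$7 = 0"
    using assms(4-6) eigenframe_eigenvector_iff[OF assms(1,2) DIM, of x \<mu>]
    by (simp_all add: forall_7 spectrum_7_def)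
  then show ?thesis
    using frame_expand[OF on DIM, of x] by (simp add: sum_7 combination_def)
qed

text \<open>The two bases of the \<open>\<mu>\<close>-eigenspace are related by an orthogonal matrix, whose determinant is
  \<open>\<plusminus>1\<close>. Only the bound from Hadamard's inequality is established here; exchanging the frames then gives equality.\<close>

lemma eigenframe_alternating3_le:
  fixes d d' :: "'a::euclidean_space ^ 7" and T :: "'a \<Rightarrow> 'a \<Rightarrow> 'a \<Rightarrow> real"
  assumes "eigenframe \<delta> (spectrum_7 lam \<mu> \<nu>) d" "eigenframe \<delta> (spectrum_7 lam \<mu> \<nu>) d'"
    and "linear \<delta>" "DIM('a) = 7" "lam \<noteq> \<mu>" "\<mu> \<noteq> \<nu>" "alternating3 T"
  shows "\<bar>T (d'$1) (d'$2) (d'$3)\<bar> \<le> \<bar>T (d$1) (d$2) (d$3)\<bar>"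
proof -
  define e :: "'a ^ 3" where "e = vector [d$1, d$2, d$3]"
  have e: "orthonormal_frame e"
    using assms(1) by (simp add: eigenframe_def orthonormal_frame_def forall_7 forall_3 e_def)
  define r :: "7 \<Rightarrow> real^3" where
    "r k = vector [d'$k \<bullet> d$1, d'$k \<bullet> d$2, d'$k \<bullet> d$3]" for k
  have *: "d'$k = combination e (r k)" "norm (r k) = 1" if "spectrum_7 lam \<mu> \<nu> $ k = \<mu>" for k
  proof -
    have "\<delta> (d'$k) = \<mu> *\<^sub>R d'$k" using assms(2) that by (simp add: eigenframe_def)
    then show eq: "d'$k = combination e (r k)"
      unfolding e_def r_def using assms by (intro eigenframe_mu_combination)
    have "r k \<bullet> r k = d'$k \<bullet> d'$k"
      using combination_inner[OF e, of "r k" "r k"] eq by simp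
    then show "norm (r k) = 1"
      using assms(2) by (simp add: norm_eq_1 eigenframe_def orthonormal_frame_def)
  qed
  have 1: "spectrum_7 lam \<mu> \<nu> $ 1 = \<mu>" "spectrum_7 lam \<mu> \<nu> $ 2 = \<mu>" "spectrum_7 lam \<mu> \<nu> $ 3 = \<mu>"
    by (simp_all add: spectrum_7_def)
  have "\<bar>T (d'$1) (d'$2) (d'$3)\<bar> = \<bar>cross3 (r 1) (r 2) \<bullet> r 3\<bar> * \<bar>T (d$1) (d$2) (d$3)\<bar>"
    unfolding *(1)[OF 1(1)] *(1)[OF 1(2)] *(1)[OF 1(3)] alternating3_combination[OF assms(7)]
    by (simp add: e_def abs_mult)
  also have "\<dots> \<le> 1 * \<bar>T (d$1) (d$2) (d$3)\<bar>"
    by (intro mult_right_mono cross3_inner_le *(2) 1) simp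
  finally show ?thesis by simp
qed

lemma eigenframe_alternating3_eq:
  fixes d d' :: "'a::euclidean_space ^ 7" and T :: "'a \<Rightarrow> 'a \<Rightarrow> 'a \<Rightarrow> real"
  assumes "eigenframe \<delta> (spectrum_7 lam \<mu> \<nu>) d" "eigenframe \<delta> (spectrum_7 lam \<mu> \<nu>) d'"
    and "linear \<delta>" "DIM('a) = 7" "lam \<noteq> \<mu>" "\<mu> \<noteq> \<nu>" "alternating3 T"
  shows "\<bar>T (d$1) (d$2) (d$3)\<bar> = \<bar>T (d'$1) (d'$2) (d'$3)\<bar>"
  using eigenframe_alternating3_le assms by (intro antisym) blast+

lemma eigenframe_lam_line:
  fixes d d' :: "'a::euclidean_space ^ 7"
  assumes "eigenframe \<delta> (spectrum_7 lam \<mu> \<nu>) d" "eigenframe \<delta> (spectrum_7 lam \<mu> \<nu>) d'"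
    and "linear \<delta>" "DIM('a) = 7" "lam \<noteq> \<mu>" "lam \<noteq> \<nu>"
  shows "d'$7 = d$7 \<or> d'$7 = - d$7"
proof -
  have DIM: "DIM('a) = CARD(7)" using assms(4) by simp
  have on: "orthonormal_frame d" using assms(1) by (simp add: eigenframe_def)
  have "\<delta> (d'$7) = lam *\<^sub>R d'$7" using assms(2) by (simp add: eigenframe_def spectrum_7_def)
  then have "d'$7 \<bullet> d$k = 0" if "k \<in> {1,2,3,4,5,6}" for k
    using that assms(5,6) eigenframe_eigenvector_iff[OF assms(1,3) DIM, of "d'$7" lam]
    by (auto simp add: forall_7 spectrum_7_def)
  then have eq: "d'$7 = (d'$7 \<bullet> d$7) *\<^sub>R d$7"
    using frame_expand[OF on DIM, of "d'$7"] by (simp add: sum_7)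
  have "(d'$7) \<bullet> (d'$7) = 1" "d$7 \<bullet> d$7 = 1"
    using assms(1,2) by (simp_all add: eigenframe_def orthonormal_frame_def)
  then have "(d'$7 \<bullet> d$7)\<^sup>2 = 1"
    using arg_cong[OF eq, of "\<lambda>x. x \<bullet> d'$7"] by (simp add: inner_commute power2_eq_square)
  then show ?thesis using eq by (auto simp: power2_eq_1_iff)
qed

text \<open>The \<open>\<nu>\<close>-eigenspace is the orthogonal complement of the sum of the other two. It therefore suffices
  to place four of the seven vectors of a frame.\<close>

lemma eigenframe_complete:
  fixes d D :: "'a::euclidean_space ^ 7"
  assumes D: "eigenframe \<delta> (spectrum_7 lam \<mu> \<nu>) D" and d: "orthonormal_frame d"
    and lin: "linear \<delta>" and dim: "DIM('a) = 7" and ne: "lam \<noteq> \<mu>" "lam \<noteq> \<nu>" "\<mu> \<noteq> \<nu>"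
    and ev: "\<delta> (d$1) = \<mu> *\<^sub>R d$1" "\<delta> (d$2) = \<mu> *\<^sub>R d$2" "\<delta> (d$3) = \<mu> *\<^sub>R d$3" "\<delta> (d$7) = lam *\<^sub>R d$7"
  shows "eigenframe \<delta> (spectrum_7 lam \<mu> \<nu>) d"
proof -
  have DIM: "DIM('a) = CARD(7)" using dim by simp
  have onD: "orthonormal_frame D" using D by (simp add: eigenframe_def)
  \<comment> \<open>An orthonormal family inside the span of another one of the same size spans the same space.\<close>
  have span: "span (($) d ` I) = span (($) D ` I)" if "($) d ` I \<subseteq> span (($) D ` I)" for I
  proof -
    have "card (($) D ` I) = card (($) d ` I)"
      by (simp add: card_image inj_on_subset[OF frame_inj[OF d]] inj_on_subset[OF frame_inj[OF onD]])
    then have "span (($) D ` I) \<subseteq> span (($) d ` I)"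
      using that frame_independent[OF d, of I] frame_independent[OF onD, of I]
      by - (rule card_ge_dim_independent[of _ "span (($) D ` I)"], simp_all add: dim_eq_card_independent)
    moreover have "span (($) d ` I) \<subseteq> span (($) D ` I)"
      using that by (simp add: span_minimal)
    ultimately show ?thesis by blast
  qed
  have sets: "{k. spectrum_7 lam \<mu> \<nu> $ k = \<mu>} = {1, 2, 3}" "{k. spectrum_7 lam \<mu> \<nu> $ k = lam} = {7}"
    unfolding set_eq_iff forall_7 using ne by (simp_all add: spectrum_7_def)
  have eig: "{x. \<delta> x = \<mu> *\<^sub>R x} = span (($) D ` {1, 2, 3})" "{x. \<delta> x = lam *\<^sub>R x} = span (($) D ` {7})"
    unfolding sets[symmetric] by (rule eigenframe_eigenspace[OF D lin DIM])+
  have "($) d ` {1, 2, 3} \<subseteq> span (($) D ` {1, 2, 3})" "($) d ` {7} \<subseteq> span (($) D ` {7})"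
    unfolding eig[symmetric] using ev by auto
  note spans = this[THEN span]
  have "\<delta> (d$k) = \<nu> *\<^sub>R d$k" if k: "k \<in> {4, 5, 6}" for k
  proof -
    have "orthogonal (d$k) x" if "x \<in> span (($) d ` ({1, 2, 3}))" for x
      using that by (rule orthogonal_to_span) (use k orthonormal_frameD[OF d] in \<open>auto simp: orthogonal_def\<close>)
    moreover have "orthogonal (d$k) x" if "x \<in> span (($) d ` {7})" for x
      using that by (rule orthogonal_to_span) (use k orthonormal_frameD[OF d] in \<open>auto simp: orthogonal_def\<close>)
    ultimately have "d$k \<bullet> D$i = 0" if "i \<in> {1, 2, 3, 7}" for i
      unfolding spans orthogonal_def using that by (auto intro: span_base)
    then show ?thesis
      unfolding eigenframe_eigenvector_iff[OF D lin DIM] forall_7 by (simp add: spectrum_7_def)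
  qed
  then show ?thesis
    using ev d unfolding eigenframe_def forall_7 by (simp add: spectrum_7_def)
qed

section \<open>Normal forms and rotated frames\<close>

text \<open>The eigenvectors that can be read off from the blocks of the normal form: those at the positions
  \<open>3\<close>, \<open>4\<close> and \<open>6\<close>, \<open>7\<close> are the columns of the two inverse rotations, written in the basis \<open>b\<close>.\<close>

definition rotate_frame :: "real \<Rightarrow> real \<Rightarrow> 'a::real_vector ^ 7 \<Rightarrow> 'a ^ 7" where
  "rotate_frame \<alpha> \<theta> b = vector
    [b$1, b$2,
     cos \<alpha> *\<^sub>R b$3 - sin \<alpha> *\<^sub>R b$4, sin \<alpha> *\<^sub>R b$3 + cos \<alpha> *\<^sub>R b$4,
     b$5,
     cos \<theta> *\<^sub>R b$6 - sin \<theta> *\<^sub>R b$7, sin \<theta> *\<^sub>R b$6 + cos \<theta> *\<^sub>R b$7]"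

lemma rotate_frame_orthonormal:
  assumes "orthonormal_frame b"
  shows "orthonormal_frame (rotate_frame \<alpha> \<theta> b)"
  by (rule orthonormal_frame_7)
     (simp_all add: rotate_frame_def orthonormal_frameD[OF assms] inner_add_left inner_add_right
        inner_diff_left inner_diff_right flip: power2_eq_square)

lemma rotated_diag_entries:
  "rotated_diag \<alpha> a b $ 1 $ 1 = a * (cos \<alpha>)\<^sup>2 + b * (sin \<alpha>)\<^sup>2"
  "rotated_diag \<alpha> a b $ 1 $ 2 = (b - a) * (cos \<alpha> * sin \<alpha>)"
  "rotated_diag \<alpha> a b $ 2 $ 1 = (b - a) * (cos \<alpha> * sin \<alpha>)"
  "rotated_diag \<alpha> a b $ 2 $ 2 = a * (sin \<alpha>)\<^sup>2 + b * (cos \<alpha>)\<^sup>2"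
proof -
  have *: "rotation \<beta> ** rotation (- \<beta>) = mat 1" for \<beta>
    by (simp add: vec_eq_iff forall_2 matrix_matrix_mult_def sum_2 rotation_def mat_def
        flip: power2_eq_square)
  have "matrix_inv (rotation \<alpha>) ** rotation \<alpha> = mat 1"
    unfolding matrix_inv_def
    by (rule someI2[of _ "rotation (- \<alpha>)"]) (use *[of \<alpha>] *[of "- \<alpha>"] in auto)
  then have "rotation (- \<alpha>) = matrix_inv (rotation \<alpha>) ** rotation \<alpha> ** rotation (- \<alpha>)"
    by simp
  also have "\<dots> = matrix_inv (rotation \<alpha>)"
    by (simp add: * flip: matrix_mul_assoc)
  finally have inv: "matrix_inv (rotation \<alpha>) = rotation (- \<alpha>)" by simp
  show "rotated_diag \<alpha> a b $ 1 $ 1 = a * (cos \<alpha>)\<^sup>2 + b * (sin \<alpha>)\<^sup>2"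
    "rotated_diag \<alpha> a b $ 1 $ 2 = (b - a) * (cos \<alpha> * sin \<alpha>)"
    "rotated_diag \<alpha> a b $ 2 $ 1 = (b - a) * (cos \<alpha> * sin \<alpha>)"
    "rotated_diag \<alpha> a b $ 2 $ 2 = a * (sin \<alpha>)\<^sup>2 + b * (cos \<alpha>)\<^sup>2"
    unfolding rotated_diag_def inv
    by (simp_all add: matrix_matrix_mult_def sum_2 rotation_def power2_eq_square algebra_simps)
qed

definition normal_form :: "real \<Rightarrow> real \<Rightarrow> real \<Rightarrow> real \<Rightarrow> real \<Rightarrow> real ^ 7 ^ 7" where
  "normal_form lam \<mu> \<nu> \<alpha> \<theta> =
     block_diag (\<mu> *\<^sub>R mat 1) (rotated_diag \<alpha> \<mu> \<nu>) \<nu> (rotated_diag \<theta> \<nu> lam)"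

lemmas normal_form_entries =
  normal_form_def block_diag_def rotated_diag_entries mat_def

lemma normal_form_symmetric: "normal_form lam \<mu> \<nu> \<alpha> \<theta> \<in> symmetric_matrices"
  unfolding symmetric_matrices_def transpose_def mem_Collect_eq vec_eq_iff forall_7
  by (simp add: normal_form_entries)

text \<open>This turns the matrix condition into a condition on eigenspaces, which refers to \<open>\<delta>\<close> without
  coordinates.\<close>

lemma normal_form_eigenframe_iff:
  fixes b :: "'a::euclidean_space ^ 7"
  assumes b: "orthonormal_frame b" and dim: "DIM('a) = 7" and lin: "linear \<delta>"
  shows "(\<chi> i j. b$i \<bullet> \<delta> (b$j)) = normal_form lam \<mu> \<nu> \<alpha> \<theta> \<longleftrightarrow>
    eigenframe \<delta> (spectrum_7 lam \<mu> \<nu>) (rotate_frame \<alpha> \<theta> b)"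
proof
  have DIM: "DIM('a) = CARD(7)" using dim by simp
  note linear = linear_add[OF lin] linear_diff[OF lin] linear_scale[OF lin]
  define ca sa ct st where "ca = cos \<alpha>" "sa = sin \<alpha>" "ct = cos \<theta>" "st = sin \<theta>"
  note cs = this
  have sa: "sa * sa = 1 - ca * ca" and st: "st * st = 1 - ct * ct"
    using sin_squared_eq[of \<alpha>] sin_squared_eq[of \<theta>] by (simp_all add: cs power2_eq_square)
  \<comment> \<open>The Pythagorean identity in a form that also rewrites right-nested products.\<close>
  have one: "sa * (sa * x) = x - ca * (ca * x)" "st * (st * x) = x - ct * (ct * x)" for x
    using arg_cong[OF sa, of "\<lambda>y. y * x"] arg_cong[OF st, of "\<lambda>y. y * x"]
    by (simp_all add: left_diff_distrib mult.assoc)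
  {
    assume N: "(\<chi> i j. b$i \<bullet> \<delta> (b$j)) = normal_form lam \<mu> \<nu> \<alpha> \<theta>"
    have col: "\<delta> (b$j) = (\<Sum>i\<in>UNIV. (normal_form lam \<mu> \<nu> \<alpha> \<theta> $ i $ j) *\<^sub>R b$i)" for j
      using frame_expand[OF b DIM, of "\<delta> (b$j)"] by (simp add: N[symmetric] inner_commute)
    have cols: "\<delta> (b$1) = \<mu> *\<^sub>R b$1" "\<delta> (b$2) = \<mu> *\<^sub>R b$2" "\<delta> (b$5) = \<nu> *\<^sub>R b$5"
      "\<delta> (b$3) = (\<mu> * ca\<^sup>2 + \<nu> * sa\<^sup>2) *\<^sub>R b$3 + ((\<nu> - \<mu>) * (ca * sa)) *\<^sub>R b$4"
      "\<delta> (b$4) = ((\<nu> - \<mu>) * (ca * sa)) *\<^sub>R b$3 + (\<mu> * sa\<^sup>2 + \<nu> * ca\<^sup>2) *\<^sub>R b$4"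
      "\<delta> (b$6) = (\<nu> * ct\<^sup>2 + lam * st\<^sup>2) *\<^sub>R b$6 + ((lam - \<nu>) * (ct * st)) *\<^sub>R b$7"
      "\<delta> (b$7) = ((lam - \<nu>) * (ct * st)) *\<^sub>R b$6 + (\<nu> * st\<^sup>2 + lam * ct\<^sup>2) *\<^sub>R b$7"
      unfolding col by (simp_all add: sum_7 normal_form_entries cs)
    show "eigenframe \<delta> (spectrum_7 lam \<mu> \<nu>) (rotate_frame \<alpha> \<theta> b)"
      unfolding eigenframe_def
    proof (rule conjI[OF rotate_frame_orthonormal[OF b]])
      show "\<forall>k. \<delta> (rotate_frame \<alpha> \<theta> b $ k) =
          spectrum_7 lam \<mu> \<nu> $ k *\<^sub>R rotate_frame \<alpha> \<theta> b $ k"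
        unfolding forall_7
        by (simp add: rotate_frame_def spectrum_7_def linear cols flip: cs)
           (simp add: algebra_simps power2_eq_square sa st one)
    qed
  }
  {
    assume "eigenframe \<delta> (spectrum_7 lam \<mu> \<nu>) (rotate_frame \<alpha> \<theta> b)"
    then have ev: "\<delta> (b$1) = \<mu> *\<^sub>R b$1" "\<delta> (b$2) = \<mu> *\<^sub>R b$2" "\<delta> (b$5) = \<nu> *\<^sub>R b$5"
      "\<delta> (ca *\<^sub>R b$3 - sa *\<^sub>R b$4) = \<mu> *\<^sub>R (ca *\<^sub>R b$3 - sa *\<^sub>R b$4)"
      "\<delta> (sa *\<^sub>R b$3 + ca *\<^sub>R b$4) = \<nu> *\<^sub>R (sa *\<^sub>R b$3 + ca *\<^sub>R b$4)"
      "\<delta> (ct *\<^sub>R b$6 - st *\<^sub>R b$7) = \<nu> *\<^sub>R (ct *\<^sub>R b$6 - st *\<^sub>R b$7)"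
      "\<delta> (st *\<^sub>R b$6 + ct *\<^sub>R b$7) = lam *\<^sub>R (st *\<^sub>R b$6 + ct *\<^sub>R b$7)"
      by (simp_all add: eigenframe_def forall_7 rotate_frame_def spectrum_7_def cs)
    \<comment> \<open>The inverse rotations recover \<open>b\<close> from the eigenvectors.\<close>
    have rotate_back: "b$3 = ca *\<^sub>R (ca *\<^sub>R b$3 - sa *\<^sub>R b$4) + sa *\<^sub>R (sa *\<^sub>R b$3 + ca *\<^sub>R b$4)"
      "b$4 = ca *\<^sub>R (sa *\<^sub>R b$3 + ca *\<^sub>R b$4) - sa *\<^sub>R (ca *\<^sub>R b$3 - sa *\<^sub>R b$4)"
      "b$6 = ct *\<^sub>R (ct *\<^sub>R b$6 - st *\<^sub>R b$7) + st *\<^sub>R (st *\<^sub>R b$6 + ct *\<^sub>R b$7)"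
      "b$7 = ct *\<^sub>R (st *\<^sub>R b$6 + ct *\<^sub>R b$7) - st *\<^sub>R (ct *\<^sub>R b$6 - st *\<^sub>R b$7)"
      by (simp_all add: algebra_simps sa st)
    have cols: "\<delta> (b$3) = ca *\<^sub>R \<mu> *\<^sub>R (ca *\<^sub>R b$3 - sa *\<^sub>R b$4) + sa *\<^sub>R \<nu> *\<^sub>R (sa *\<^sub>R b$3 + ca *\<^sub>R b$4)"
      "\<delta> (b$4) = ca *\<^sub>R \<nu> *\<^sub>R (sa *\<^sub>R b$3 + ca *\<^sub>R b$4) - sa *\<^sub>R \<mu> *\<^sub>R (ca *\<^sub>R b$3 - sa *\<^sub>R b$4)"
      "\<delta> (b$6) = ct *\<^sub>R \<nu> *\<^sub>R (ct *\<^sub>R b$6 - st *\<^sub>R b$7) + st *\<^sub>R lam *\<^sub>R (st *\<^sub>R b$6 + ct *\<^sub>R b$7)"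
      "\<delta> (b$7) = ct *\<^sub>R lam *\<^sub>R (st *\<^sub>R b$6 + ct *\<^sub>R b$7) - st *\<^sub>R \<nu> *\<^sub>R (ct *\<^sub>R b$6 - st *\<^sub>R b$7)"
      unfolding ev(4-7)[symmetric] linear_scale[OF lin, symmetric] linear_add[OF lin, symmetric]
        linear_diff[OF lin, symmetric] rotate_back[symmetric] by (rule refl)+
    show "(\<chi> i j. b$i \<bullet> \<delta> (b$j)) = normal_form lam \<mu> \<nu> \<alpha> \<theta>"
      unfolding vec_eq_iff forall_7
      by (simp add: normal_form_entries ev(1-3) cols inner_add_right inner_diff_right
          orthonormal_frameD[OF b] flip: cs)
         (simp add: algebra_simps power2_eq_square)
  }
qed

text \<open>Applied to the standard basis of \<open>real ^ 7\<close>, the criterion exhibits an eigenframe of the normal form itself,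
  and the multiplicities follow.\<close>

lemma normal_form_Sym_with:
  assumes "lam \<noteq> \<mu>" "lam \<noteq> \<nu>" "\<mu> \<noteq> \<nu>"
  shows "normal_form lam \<mu> \<nu> \<alpha> \<theta> \<in> Sym_with {(lam, 1), (\<mu>, 3), (\<nu>, 3)}"
proof -
  let ?N = "normal_form lam \<mu> \<nu> \<alpha> \<theta>"
  define b :: "(real^7)^7" where "b = (\<chi> i. axis i 1)"
  have b: "orthonormal_frame b"
    by (simp add: orthonormal_frame_def b_def inner_axis_axis)
  have "(\<chi> i j. b$i \<bullet> (?N *v b$j)) = ?N"
    by (simp add: vec_eq_iff b_def inner_axis' matrix_vector_mult_basis column_def)
  then have "eigenframe ((*v) ?N) (spectrum_7 lam \<mu> \<nu>) (rotate_frame \<alpha> \<theta> b)"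
    by (subst normal_form_eigenframe_iff[OF b, symmetric]) simp_all
  then show ?thesis
    using eigenvalue_pairs_spectrum_7[OF _ assms] normal_form_symmetric
    by (auto simp: Sym_with_def)
qed

section \<open>Vector products and Cayley bases\<close>

locale vector_product_space =
  fixes vp :: "'a::euclidean_space \<Rightarrow> 'a \<Rightarrow> 'a" (infixl "\<odot>" 70)
  assumes vector_product: "vector_product vp"
begin

lemma bilinear: "bilinear (\<odot>)" and vp_self [simp]: "x \<odot> x = 0"
  using vector_product by (auto simp: vector_product_def)

lemmas vp_linear =
  bilinear_ladd[OF bilinear] bilinear_radd[OF bilinear]
  bilinear_lmul[OF bilinear] bilinear_rmul[OF bilinear]
  bilinear_lneg[OF bilinear] bilinear_rneg[OF bilinear]
  bilinear_lsub[OF bilinear] bilinear_rsub[OF bilinear]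
  bilinear_lzero[OF bilinear] bilinear_rzero[OF bilinear]

lemma vp_anticommute: "y \<odot> x = - (x \<odot> y)"
proof -
  have "(x + y) \<odot> (x + y) = x \<odot> y + y \<odot> x"
    unfolding vp_linear by simp
  then show ?thesis by (simp add: eq_neg_iff_add_eq_0 add.commute)
qed

lemma vp_orthogonal_pair:
  assumes "x \<bullet> y = 0"
  shows "(x \<odot> y) \<bullet> x = 0" and "(x \<odot> y) \<bullet> (x \<odot> y) = (x \<bullet> x) * (y \<bullet> y)"
proof -
  have "(x \<odot> y) \<bullet> x = 0 \<and> (x \<odot> y) \<bullet> (x \<odot> y) = (x \<bullet> x) * (y \<bullet> y)"
  proof (cases "x = 0 \<or> y = 0")
    case True
    then show ?thesis by (auto simp: vp_linear)
  next
    case False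
    define u v where "u = x /\<^sub>R norm x" and "v = y /\<^sub>R norm y"
    have x: "x = norm x *\<^sub>R u" and y: "y = norm y *\<^sub>R v"
      using False by (auto simp: u_def v_def)
    have "orthonormal [u, v]"
      using False assms by (simp add: orthonormal_def u_def v_def orthogonal_def)
    then have "orthonormal [u, v, u \<odot> v]"
      using vector_product by (simp add: vector_product_def)
    then have uv: "u \<bullet> (u \<odot> v) = 0" "(u \<odot> v) \<bullet> (u \<odot> v) = 1"
      by (simp_all add: orthonormal_def orthogonal_def norm_eq_1)
    have xy: "x \<odot> y = (norm x * norm y) *\<^sub>R (u \<odot> v)"
      by (subst x, subst y) (simp add: vp_linear)
    have "(x \<odot> y) \<bullet> x = 0"
      unfolding xy by (subst (2) x) (simp add: inner_commute uv)
    moreover have "(x \<odot> y) \<bullet> (x \<odot> y) = (x \<bullet> x) * (y \<bullet> y)"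
      unfolding xy inner_scaleR_left inner_scaleR_right uv(2)
      by (simp add: dot_square_norm power2_eq_square)
    ultimately show ?thesis by simp
  qed
  then show "(x \<odot> y) \<bullet> x = 0" and "(x \<odot> y) \<bullet> (x \<odot> y) = (x \<bullet> x) * (y \<bullet> y)"
    by auto
qed

text \<open>Subtracting from \<open>y\<close> its component along \<open>x\<close> does not change \<open>x \<odot> y\<close>, which reduces the general
  case to orthogonal factors.\<close>

lemma vp_inner_left: "(x \<odot> y) \<bullet> x = 0"
  and vp_inner_self: "(x \<odot> y) \<bullet> (x \<odot> y) = (x \<bullet> x) * (y \<bullet> y) - (x \<bullet> y)\<^sup>2"
proof -
  define y' where "y' = y - ((x \<bullet> y) / (x \<bullet> x)) *\<^sub>R x"
  have orth: "x \<bullet> y' = 0"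
    by (cases "x = 0") (simp_all add: y'_def inner_diff_right)
  have xy: "x \<odot> y = x \<odot> y'"
    by (simp add: y'_def vp_linear)
  have "y' \<bullet> y' = y \<bullet> y' - ((x \<bullet> y) / (x \<bullet> x)) * (x \<bullet> y')"
    by (subst (1) y'_def) (simp add: inner_diff_left)
  also have "\<dots> = y \<bullet> y - ((x \<bullet> y) / (x \<bullet> x)) * (x \<bullet> y)"
    unfolding orth by (simp add: y'_def inner_diff_right inner_commute)
  finally have "(x \<bullet> x) * (y' \<bullet> y') = (x \<bullet> x) * (y \<bullet> y) - (x \<bullet> y)\<^sup>2"
    by (cases "x = 0") (simp_all add: power2_eq_square right_diff_distrib)
  then show "(x \<odot> y) \<bullet> x = 0" "(x \<odot> y) \<bullet> (x \<odot> y) = (x \<bullet> x) * (y \<bullet> y) - (x \<bullet> y)\<^sup>2"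
    unfolding xy using vp_orthogonal_pair[OF orth] by simp_all
qed

text \<open>The trilinear form \<open>(x \<odot> y) \<bullet> z\<close> vanishes for \<open>z = x\<close>, so it is alternating and hence invariant under
  cyclic permutations.\<close>

lemma vp_inner_cyclic: "(x \<odot> y) \<bullet> z = (y \<odot> z) \<bullet> x"
proof -
  have "((x + z) \<odot> y) \<bullet> (x + z) = (x \<odot> y) \<bullet> z + (z \<odot> y) \<bullet> x"
    by (simp add: vp_linear inner_left_distrib inner_right_distrib vp_inner_left)
  then have "(x \<odot> y) \<bullet> z + (z \<odot> y) \<bullet> x = 0"
    by (simp add: vp_inner_left)
  then show ?thesis using vp_anticommute[of z y] by simp
qed

lemma vp_inner_right: "(x \<odot> y) \<bullet> y = 0"
  using vp_inner_cyclic[of x y y] by simp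

lemma vp_inner_left': "x \<bullet> (x \<odot> y) = 0" and vp_inner_right': "y \<bullet> (x \<odot> y) = 0"
  using vp_inner_left vp_inner_right by (simp_all add: inner_commute)

lemma vp_inner_common: "(x \<odot> y) \<bullet> (x \<odot> z) = (x \<bullet> x) * (y \<bullet> z) - (x \<bullet> y) * (x \<bullet> z)"
proof -
  have "(x \<odot> (y + z)) \<bullet> (x \<odot> (y + z)) =
      (x \<odot> y) \<bullet> (x \<odot> y) + 2 * ((x \<odot> y) \<bullet> (x \<odot> z)) + (x \<odot> z) \<bullet> (x \<odot> z)"
    by (simp add: vp_linear inner_left_distrib inner_right_distrib inner_commute)
  then show ?thesis
    unfolding vp_inner_self
    by (simp add: inner_left_distrib inner_right_distrib inner_commute power2_eq_square algebra_simps)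
qed

text \<open>Left multiplication by \<open>x\<close> is skew-adjoint, so testing against \<open>w\<close> gives
  \<open>- (x \<odot> y) \<bullet> (x \<odot> w)\<close>, which the polarised norm identity evaluates.\<close>

lemma vp_double: "x \<odot> (x \<odot> y) = (x \<bullet> y) *\<^sub>R x - (x \<bullet> x) *\<^sub>R y"
proof -
  have "(x \<odot> (x \<odot> y)) \<bullet> w = ((x \<bullet> y) *\<^sub>R x - (x \<bullet> x) *\<^sub>R y) \<bullet> w" for w
  proof -
    have "(x \<odot> (x \<odot> y)) \<bullet> w = (w \<odot> x) \<bullet> (x \<odot> y)"
      using vp_inner_cyclic[of w x "x \<odot> y"] by (simp add: inner_commute)
    also have "\<dots> = - ((x \<odot> w) \<bullet> (x \<odot> y))"
      by (simp add: vp_anticommute[of w x])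
    finally show ?thesis
      by (simp add: vp_inner_common inner_diff_left inner_diff_right inner_commute)
  qed
  then show ?thesis by (rule vector_eq_rdot[THEN iffD1, OF allI])
qed

lemma vp_double_polarised:
  "x \<odot> (y \<odot> w) + y \<odot> (x \<odot> w) = (x \<bullet> w) *\<^sub>R y + (y \<bullet> w) *\<^sub>R x - (2 * (x \<bullet> y)) *\<^sub>R w"
proof -
  have "(x + y) \<odot> ((x + y) \<odot> w) =
      x \<odot> (x \<odot> w) + y \<odot> (y \<odot> w) + (x \<odot> (y \<odot> w) + y \<odot> (x \<odot> w))"
    by (simp add: vp_linear)
  then show ?thesis
    unfolding vp_double
    by (simp add: inner_left_distrib inner_right_distrib inner_commute algebra_simps)
qed

text \<open>Polarising \<open>vp_double\<close> shows that left multiplications by orthogonal vectors anticommute, up to terms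
  that vanish on a third orthogonal vector. Together with \<open>vp_double\<close> this rule yields all products of Cayley basis vectors.\<close>

lemma vp_antiassociative:
  assumes "x \<bullet> y = 0" "x \<bullet> w = 0" "y \<bullet> w = 0"
  shows "x \<odot> (y \<odot> w) = - ((x \<odot> y) \<odot> w)"
proof -
  have "x \<odot> (w \<odot> y) + w \<odot> (x \<odot> y) = 0"
    using assms by (simp add: vp_double_polarised inner_commute)
  then show ?thesis
    by (simp add: vp_anticommute[of w y] vp_anticommute[of w "x \<odot> y"] vp_linear)
       (metis add.inverse_inverse neg_eq_iff_add_eq_0 add.commute)
qed

lemma vp_common_factor:
  assumes "x \<bullet> y = 0" "x \<bullet> z = 0" "y \<bullet> z = 0" "(x \<odot> y) \<bullet> z = 0"
  shows "(x \<odot> z) \<odot> (y \<odot> z) = - ((z \<bullet> z) *\<^sub>R (x \<odot> y))"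
proof -
  have "(x \<odot> z) \<bullet> y = 0"
    using assms(4) vp_inner_cyclic[of x z y] vp_inner_cyclic[of y x z] vp_anticommute[of y x] vp_inner_cyclic[of z y x] by simp
  then have "(x \<odot> z) \<odot> (y \<odot> z) = - (((x \<odot> z) \<odot> y) \<odot> z)"
    using assms(3) by (intro vp_antiassociative) (simp_all add: vp_inner_right)
  also have "(x \<odot> z) \<odot> y = - (y \<odot> (x \<odot> z))" by (rule vp_anticommute)
  also have "y \<odot> (x \<odot> z) = - ((y \<odot> x) \<odot> z)"
    using assms by (intro vp_antiassociative) (simp_all add: inner_commute)
  also have "- ((- (- ((y \<odot> x) \<odot> z))) \<odot> z) = z \<odot> (z \<odot> (x \<odot> y))"
    by (simp add: vp_linear vp_anticommute[of y x] vp_anticommute[of "x \<odot> y" z]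
        vp_anticommute[of "z \<odot> (x \<odot> y)" z])
  also have "\<dots> = - ((z \<bullet> z) *\<^sub>R (x \<odot> y))"
    using assms(4) by (simp add: vp_double inner_commute)
  finally show ?thesis .
qed

lemma cayley_tripleD:
  assumes "cayley_triple (\<odot>) (u, v, z)"
  shows "u \<bullet> u = 1" "v \<bullet> v = 1" "z \<bullet> z = 1" "u \<bullet> v = 0" "u \<bullet> z = 0" "v \<bullet> z = 0" "(u \<odot> v) \<bullet> z = 0"
  using assms by (auto simp: orthonormal_def orthogonal_def norm_eq_1)

lemma cayley_tripleI:
  assumes "u \<bullet> u = 1" "v \<bullet> v = 1" "z \<bullet> z = 1" "u \<bullet> v = 0" "u \<bullet> z = 0" "v \<bullet> z = 0" "(u \<odot> v) \<bullet> z = 0"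
  shows "cayley_triple (\<odot>) (u, v, z)"
  using assms vp_inner_left[of u v] vp_inner_right[of u v] vp_inner_self[of u v]
  by (auto simp: orthonormal_def orthogonal_def norm_eq_1 inner_commute)

text \<open>The multiplication table of a Cayley basis. Its entries are the same for every triple, which is the
  reason for transitivity of the automorphism group below.\<close>

lemma cayley_products:
  assumes "cayley_triple (\<odot>) (u, v, z)"
  defines "w \<equiv> u \<odot> v"
  shows "u \<odot> w = - v" "v \<odot> w = u"
    "u \<odot> (u \<odot> z) = - z" "v \<odot> (v \<odot> z) = - z" "w \<odot> (w \<odot> z) = - z"
    "z \<odot> (u \<odot> z) = u" "z \<odot> (v \<odot> z) = v" "z \<odot> (w \<odot> z) = w"
    "u \<odot> (v \<odot> z) = - (w \<odot> z)" "v \<odot> (u \<odot> z) = w \<odot> z"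
    "u \<odot> (w \<odot> z) = v \<odot> z" "w \<odot> (u \<odot> z) = - (v \<odot> z)"
    "v \<odot> (w \<odot> z) = - (u \<odot> z)" "w \<odot> (v \<odot> z) = u \<odot> z"
    "(u \<odot> z) \<odot> (v \<odot> z) = - w" "(u \<odot> z) \<odot> (w \<odot> z) = v" "(v \<odot> z) \<odot> (w \<odot> z) = - u"
proof -
  note c = cayley_tripleD[OF assms(1), folded w_def]
  have w: "w \<bullet> w = 1" "u \<bullet> w = 0" "v \<bullet> w = 0"
    using c vp_inner_left[of u v] vp_inner_right[of u v] vp_inner_self[of u v]
    by (simp_all add: w_def inner_commute)
  show uw: "u \<odot> w = - v" using c by (simp add: w_def vp_double)
  have "v \<odot> (v \<odot> u) = - u" using c by (simp add: vp_double inner_commute)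
  then show vw: "v \<odot> w = u"
    by (simp add: w_def vp_anticommute[of v u] vp_linear)
  show "u \<odot> (u \<odot> z) = - z" "v \<odot> (v \<odot> z) = - z" "w \<odot> (w \<odot> z) = - z"
    using c w by (simp_all add: vp_double)
  have z: "z \<odot> (x \<odot> z) = x" if "x \<bullet> z = 0" for x
    using c that by (simp add: vp_anticommute[of x z] vp_linear vp_double inner_commute)
  show "z \<odot> (u \<odot> z) = u" "z \<odot> (v \<odot> z) = v" "z \<odot> (w \<odot> z) = w"
    using c w z by simp_all
  show "u \<odot> (v \<odot> z) = - (w \<odot> z)"
    unfolding w_def using c by (intro vp_antiassociative)
  show "v \<odot> (u \<odot> z) = w \<odot> z"
    using c vp_antiassociative[of v u z] by (simp add: vp_anticommute[of v u] vp_linear w_def inner_commute)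
  show "u \<odot> (w \<odot> z) = v \<odot> z"
    using c w vp_antiassociative[of u w z] by (simp add: uw vp_linear)
  show "w \<odot> (u \<odot> z) = - (v \<odot> z)"
    using c w vp_antiassociative[of w u z]
    by (simp add: vp_anticommute[of w u] uw vp_linear inner_commute)
  show "v \<odot> (w \<odot> z) = - (u \<odot> z)"
    using c w vp_antiassociative[of v w z] by (simp add: vw vp_linear)
  show "w \<odot> (v \<odot> z) = u \<odot> z"
    using c w vp_antiassociative[of w v z]
    by (simp add: vp_anticommute[of w v] vw vp_linear inner_commute)
  show "(u \<odot> z) \<odot> (v \<odot> z) = - w"
    using c vp_common_factor[of u v z] by (simp add: w_def)
  show "(u \<odot> z) \<odot> (w \<odot> z) = v"
    using c w vp_common_factor[of u w z] by (simp add: uw)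
  show "(v \<odot> z) \<odot> (w \<odot> z) = - u"
    using c w vp_common_factor[of v w z] by (simp add: vw)
qed

lemma cayley_basis_orthonormal:
  assumes "cayley_triple (\<odot>) s"
  shows "orthonormal_frame (cayley_basis (\<odot>) s)"
proof -
  obtain u v z where s: "s = (u, v, z)" by (cases s) auto
  define w where "w = u \<odot> v"
  note t = assms[unfolded s]
  note c = cayley_tripleD[OF t, folded w_def]
  note p = cayley_products[OF t, folded w_def]
  have w: "w \<bullet> w = 1" "u \<bullet> w = 0" "v \<bullet> w = 0"
    using c vp_inner_left[of u v] vp_inner_right[of u v] vp_inner_self[of u v]
    by (simp_all add: w_def inner_commute)
  have unit: "(x \<odot> z) \<bullet> (x \<odot> z) = 1" if "x \<bullet> x = 1" "x \<bullet> z = 0" for x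
    using c that by (simp add: vp_inner_self)
  have orth: "(x \<odot> z) \<bullet> (y \<odot> z) = x \<bullet> y" if "x \<bullet> z = 0" "y \<bullet> z = 0" for x y
    using c that vp_inner_common[of z x y]
    by (simp add: vp_anticommute[of x z] vp_anticommute[of y z] inner_commute)
  have mixed: "x \<bullet> (y \<odot> z) = (x \<odot> y) \<bullet> z" for x y
    using vp_inner_cyclic[of x y z] by (simp add: inner_commute)
  have "v \<odot> u = - w" "w \<odot> u = v" "w \<odot> v = - u"
    using p(1,2) vp_anticommute[of v u] vp_anticommute[of w u] vp_anticommute[of w v]
    by (simp_all add: w_def)
  then show ?thesis
    unfolding s cayley_basis.simps w_def[symmetric]
    by (intro orthonormal_frame_7)
       (simp_all add: c w p unit orth mixed[of u] mixed[of v] mixed[of w]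
          vp_inner_right inner_commute[of z "_ \<odot> z"] w_def[symmetric])
qed

section \<open>Orbits as changes of Cayley basis\<close>

lemma G2_cayley_basis:
  assumes "g \<in> G2 (\<odot>)"
  shows "cayley_basis (\<odot>) (g u, g v, g z) $ i = g (cayley_basis (\<odot>) (u, v, z) $ i)"
proof -
  have "\<forall>i. cayley_basis (\<odot>) (g u, g v, g z) $ i = g (cayley_basis (\<odot>) (u, v, z) $ i)"
    unfolding forall_7 using assms by (simp add: G2_def)
  then show ?thesis by blast
qed

lemma G2_cayley_triple:
  assumes "g \<in> G2 (\<odot>)" "cayley_triple (\<odot>) (u, v, z)"
  shows "cayley_triple (\<odot>) (g u, g v, g z)"
proof -
  have "g x \<bullet> g y = x \<bullet> y" "g x \<odot> g y = g (x \<odot> y)" for x y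
    using assms(1) by (auto simp: G2_def orthogonal_transformation_def)
  then show ?thesis
    using cayley_tripleD[OF assms(2)] by (intro cayley_tripleI) simp_all
qed

text \<open>The isometry carrying one Cayley basis to the other respects all products of basis vectors, because both
  bases have the same multiplication table; bilinearity extends this to the whole space.\<close>

lemma G2_transitive:
  assumes dim: "DIM('a) = 7"
    and s: "cayley_triple (\<odot>) (u, v, z)" and t: "cayley_triple (\<odot>) (u', v', z')"
  obtains g where "g \<in> G2 (\<odot>)" "g u = u'" "g v = v'" "g z = z'"
proof -
  have DIM: "DIM('a) = CARD(7)" using dim by simp
  define b b' where "b = cayley_basis (\<odot>) (u, v, z)" "b' = cayley_basis (\<odot>) (u', v', z')"
  note bb = this
  have b: "orthonormal_frame b" "orthonormal_frame b'"
    unfolding bb by (rule cayley_basis_orthonormal, fact s, rule cayley_basis_orthonormal, fact t)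
  obtain g where g: "orthogonal_transformation g" "\<And>i. g (b$i) = b'$i"
    using orthogonal_transformation_of_frames[OF b DIM] by blast
  have lin: "linear g" using g(1) by (simp add: orthogonal_transformation_def)
  note gk = g(2)[of 1] g(2)[of 2] g(2)[of 3] g(2)[of 4] g(2)[of 5] g(2)[of 6] g(2)[of 7]
  note gb = gk[unfolded bb cayley_basis.simps vector_7]
  have basis: "g (b$i \<odot> b$j) = g (b$i) \<odot> g (b$j)" for i j
  proof -
    note p = cayley_products[OF s] and q = cayley_products[OF t]
    \<comment> \<open>Up to order of the factors these are all products of two distinct basis vectors.\<close>
    have lt: "g (b$1 \<odot> b$2) = b'$1 \<odot> b'$2" "g (b$1 \<odot> b$3) = b'$1 \<odot> b'$3"
      "g (b$1 \<odot> b$4) = b'$1 \<odot> b'$4" "g (b$1 \<odot> b$5) = b'$1 \<odot> b'$5"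
      "g (b$1 \<odot> b$6) = b'$1 \<odot> b'$6" "g (b$1 \<odot> b$7) = b'$1 \<odot> b'$7"
      "g (b$2 \<odot> b$3) = b'$2 \<odot> b'$3" "g (b$2 \<odot> b$4) = b'$2 \<odot> b'$4"
      "g (b$2 \<odot> b$5) = b'$2 \<odot> b'$5" "g (b$2 \<odot> b$6) = b'$2 \<odot> b'$6"
      "g (b$2 \<odot> b$7) = b'$2 \<odot> b'$7" "g (b$3 \<odot> b$4) = b'$3 \<odot> b'$4"
      "g (b$3 \<odot> b$5) = b'$3 \<odot> b'$5" "g (b$3 \<odot> b$6) = b'$3 \<odot> b'$6"
      "g (b$3 \<odot> b$7) = b'$3 \<odot> b'$7" "g (b$4 \<odot> b$5) = b'$4 \<odot> b'$5"
      "g (b$4 \<odot> b$6) = b'$4 \<odot> b'$6" "g (b$4 \<odot> b$7) = b'$4 \<odot> b'$7"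
      "g (b$5 \<odot> b$6) = b'$5 \<odot> b'$6" "g (b$5 \<odot> b$7) = b'$5 \<odot> b'$7"
      "g (b$6 \<odot> b$7) = b'$6 \<odot> b'$7"
      by (simp_all add: bb p q gb linear_neg[OF lin])
    have swap: "g (x \<odot> y) = x' \<odot> y'" if "g (y \<odot> x) = y' \<odot> x'" for x y x' y'
      using that by (simp add: vp_anticommute[of y x] vp_anticommute[of y' x'] linear_neg[OF lin])
    have "\<forall>i j. g (b$i \<odot> b$j) = b'$i \<odot> b'$j"
      unfolding forall_7 by (simp add: lt lt[THEN swap] linear_0[OF lin])
    then show ?thesis by (simp add: g(2))
  qed
  have "g (x \<odot> y) = g x \<odot> g y" for x y
  proof (rule bilinear_eq[where f = "\<lambda>x y. g (x \<odot> y)" and g = "\<lambda>x y. g x \<odot> g y"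
        and B = "range (($) b)" and C = "range (($) b)" and S = UNIV and T = UNIV])
    show "bilinear (\<lambda>x y. g (x \<odot> y))" "bilinear (\<lambda>x y. g x \<odot> g y)"
      by (auto simp: bilinear_def vp_linear linear_add[OF lin] linear_scale[OF lin] intro!: linearI)
  qed (use basis frame_span[OF b(1) DIM] in auto)
  then have "g \<in> G2 (\<odot>)" using g(1) by (simp add: G2_def)
  then show ?thesis using that gb by blast
qed

lemma matrix_wrt_inj:
  assumes dim: "DIM('a) = 7" and s: "cayley_triple (\<odot>) s"
  shows "inj_on (matrix_wrt (\<odot>) s) symmetric_endos"
proof (rule inj_onI)
  have DIM: "DIM('a) = CARD(7)" using dim by simp
  let ?b = "cayley_basis (\<odot>) s"
  have b: "orthonormal_frame ?b" using s by (rule cayley_basis_orthonormal)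
  fix \<delta> \<delta>' :: "'a \<Rightarrow> 'a"
  assume lin: "\<delta> \<in> symmetric_endos" "\<delta>' \<in> symmetric_endos"
    and eq: "matrix_wrt (\<odot>) s \<delta> = matrix_wrt (\<odot>) s \<delta>'"
  have "\<delta> (?b$j) = \<delta>' (?b$j)" for j
  proof (rule frame_ext[OF b DIM])
    fix i
    have "matrix_wrt (\<odot>) s \<delta> $ i $ j = matrix_wrt (\<odot>) s \<delta>' $ i $ j" by (simp only: eq)
    then show "\<delta> (?b$j) \<bullet> ?b$i = \<delta>' (?b$j) \<bullet> ?b$i"
      by (simp add: matrix_wrt_def inner_commute)
  qed
  then have "\<delta> x = \<delta>' x" for x
    using lin frame_span[OF b DIM]
    by (intro linear_eq_on[of \<delta> \<delta>' x "range (($) ?b)"]) (auto simp: symmetric_endos_def)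
  then show "\<delta> = \<delta>'" by blast
qed

lemma matrix_wrt_surj:
  assumes s: "cayley_triple (\<odot>) s" and M: "M \<in> symmetric_matrices"
  shows "M \<in> matrix_wrt (\<odot>) s ` symmetric_endos"
proof
  let ?b = "cayley_basis (\<odot>) s"
  have b: "orthonormal_frame ?b" using s by (rule cayley_basis_orthonormal)
  define \<delta> where "\<delta> x = (\<Sum>i\<in>UNIV. \<Sum>j\<in>UNIV. (M$i$j * (x \<bullet> ?b$j)) *\<^sub>R ?b$i)" for x
  have inner: "\<delta> x \<bullet> y = (\<Sum>i\<in>UNIV. \<Sum>j\<in>UNIV. M$i$j * (y \<bullet> ?b$i) * (x \<bullet> ?b$j))" for x y
    by (simp add: \<delta>_def inner_sum_left inner_commute[of y] ac_simps)
  show "M = matrix_wrt (\<odot>) s \<delta>"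
    by (simp add: vec_eq_iff matrix_wrt_def inner_commute[of _ "\<delta> _"] inner
        orthonormal_frameD[OF b] mult_delta_right)
  have M_sym: "M$j$i = M$i$j" for i j
  proof -
    have "transpose M $ i $ j = M$i$j" using M by (simp add: symmetric_matrices_def)
    then show ?thesis by (simp add: transpose_def)
  qed
  have "\<delta> x \<bullet> y = \<delta> y \<bullet> x" for x y
    unfolding inner by (subst sum.swap) (simp add: M_sym mult.assoc mult.commute mult.left_commute)
  moreover have "linear \<delta>"
    by (rule linearI)
       (simp_all add: \<delta>_def inner_left_distrib distrib_left scaleR_left_distrib sum.distrib
         scaleR_sum_right algebra_simps)
  ultimately show "\<delta> \<in> symmetric_endos"
    by (simp add: symmetric_endos_def inner_commute)
qed

lemma endo_of:
  assumes "DIM('a) = 7" "cayley_triple (\<odot>) s" "M \<in> symmetric_matrices"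
  shows "endo_of (\<odot>) s M \<in> symmetric_endos" "matrix_wrt (\<odot>) s (endo_of (\<odot>) s M) = M"
  unfolding endo_of_def
  by (rule the_inv_into_into[OF matrix_wrt_inj[OF assms(1,2)] matrix_wrt_surj[OF assms(2,3)] order_refl])
     (rule f_the_inv_into_f[OF matrix_wrt_inj[OF assms(1,2)] matrix_wrt_surj[OF assms(2,3)]])

text \<open>Conjugating \<open>\<delta>\<close> by \<open>g\<close> amounts to moving the basis by \<open>g\<close>, since \<open>g\<close> is orthogonal.\<close>

lemma act_matrix_wrt:
  assumes "g \<in> G2 (\<odot>)"
  shows "act (\<odot>) (u, v, z) M g = matrix_wrt (\<odot>) (g u, g v, g z) (endo_of (\<odot>) (u, v, z) M)"
proof -
  have orth: "orthogonal_transformation g" using assms by (simp add: G2_def)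
  have "x \<bullet> inv g y = g x \<bullet> y" for x y
  proof -
    have "g (inv g y) = y"
      using orthogonal_transformation_surj[OF orth] by (simp add: surj_f_inv_f)
    then show ?thesis
      using orth unfolding orthogonal_transformation_def by metis
  qed
  then show ?thesis
    unfolding act_def matrix_wrt_def G2_cayley_basis[OF assms] by simp
qed

text \<open>By transitivity the automorphisms can be replaced by the triples that they produce: from here on the
  endomorphism is fixed and only the basis varies.\<close>

lemma orbit_eq_matrix_wrt:
  assumes dim: "DIM('a) = 7" and s: "cayley_triple (\<odot>) s"
  shows "orbit (\<odot>) s M = {matrix_wrt (\<odot>) t (endo_of (\<odot>) s M) | t. cayley_triple (\<odot>) t}"
proof -
  obtain u v z where suvz: "s = (u, v, z)" by (cases s) auto
  note s' = s[unfolded suvz]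
  show ?thesis
  proof (intro set_eqI iffI)
    fix N assume "N \<in> orbit (\<odot>) s M"
    then obtain g where g: "g \<in> G2 (\<odot>)" "N = act (\<odot>) s M g" by (auto simp: orbit_def)
    then have "N = matrix_wrt (\<odot>) (g u, g v, g z) (endo_of (\<odot>) s M)"
      by (simp only: suvz act_matrix_wrt)
    then show "N \<in> {matrix_wrt (\<odot>) t (endo_of (\<odot>) s M) | t. cayley_triple (\<odot>) t}"
      using G2_cayley_triple[OF g(1) s'] by blast
  next
    fix N assume "N \<in> {matrix_wrt (\<odot>) t (endo_of (\<odot>) s M) | t. cayley_triple (\<odot>) t}"
    then obtain u' v' z' where t: "cayley_triple (\<odot>) (u', v', z')"
      and N: "N = matrix_wrt (\<odot>) (u', v', z') (endo_of (\<odot>) s M)" by auto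
    obtain g where g: "g \<in> G2 (\<odot>)" "g u = u'" "g v = v'" "g z = z'"
      using G2_transitive[OF dim s' t] .
    then have "N = act (\<odot>) s M g" unfolding N suvz act_matrix_wrt[OF g(1)] by simp
    then show "N \<in> orbit (\<odot>) s M" using g(1) by (auto simp: orbit_def)
  qed
qed

text \<open>The coordinate map \<open>real ^ 7 \<rightarrow> V\<close> of the Cayley basis is an isometry that intertwines the matrix and
  the endomorphism, so it carries eigenframes to eigenframes.\<close>

lemma endo_of_eigenframe:
  assumes dim: "DIM('a) = 7" and s: "cayley_triple (\<odot>) s" and M: "M \<in> symmetric_matrices"
    and d: "eigenframe ((*v) M) \<epsilon> (d :: (real^7)^7)"
  obtains D where "eigenframe (endo_of (\<odot>) s M) \<epsilon> D"
proof
  have DIM: "DIM('a) = CARD(7)" using dim by simp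
  let ?b = "cayley_basis (\<odot>) s" and ?\<delta> = "endo_of (\<odot>) s M"
  define J where "J x = (\<Sum>i\<in>UNIV. (x$i) *\<^sub>R ?b$i)" for x :: "real^7"
  have b: "orthonormal_frame ?b" using s by (rule cayley_basis_orthonormal)
  have lin: "linear ?\<delta>" using endo_of(1)[OF dim s M] by (simp add: symmetric_endos_def)
  have Jb: "J x \<bullet> ?b$j = x$j" for x j
    by (simp add: J_def inner_sum_left orthonormal_frameD[OF b] if_distrib cong: if_cong)
  have J_scale: "J (a *\<^sub>R x) = a *\<^sub>R J x" for a x
    by (simp add: J_def scaleR_sum_right)
  have JJ: "J x \<bullet> J y = x \<bullet> y" for x y
  proof -
    have "J x \<bullet> J y = (\<Sum>j\<in>UNIV. y$j * (J x \<bullet> ?b$j))"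
      by (subst (2) J_def) (simp add: inner_sum_right)
    then show ?thesis by (simp add: Jb inner_vec_def mult.commute)
  qed
  have entry: "?b$i \<bullet> ?\<delta> (?b$j) = M$i$j" for i j
    using arg_cong[OF endo_of(2)[OF dim s M], of "\<lambda>N. N$i$j"] by (simp add: matrix_wrt_def)
  have JM: "?\<delta> (J x) = J (M *v x)" for x
  proof (rule frame_ext[OF b DIM])
    fix i
    have "?\<delta> (J x) \<bullet> ?b$i = (\<Sum>j\<in>UNIV. x$j * (?b$i \<bullet> ?\<delta> (?b$j)))"
      by (simp add: J_def linear_sum[OF lin] linear_scale[OF lin] inner_sum_left
          inner_commute[of "?\<delta> _" "?b$i"])
    then show "?\<delta> (J x) \<bullet> ?b$i = J (M *v x) \<bullet> ?b$i"
      by (simp add: Jb entry matrix_vector_mult_def mult.commute)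
  qed
  have "?\<delta> (J (d$k)) = \<epsilon>$k *\<^sub>R J (d$k)" for k
    using d by (simp add: JM J_scale eigenframe_def)
  then show "eigenframe ?\<delta> \<epsilon> (\<chi> k. J (d$k))"
    using d by (simp add: eigenframe_def orthonormal_frame_def JJ)
qed

section \<open>The angles are invariants\<close>

text \<open>The vector-valued coassociative form: for mutually orthogonal arguments it is
  \<open>x \<odot> (y \<odot> w)\<close>, and the correction terms make it alternating everywhere.\<close>

definition coassociative :: "'a \<Rightarrow> 'a \<Rightarrow> 'a \<Rightarrow> 'a" where
  "coassociative x y w = x \<odot> (y \<odot> w) + (x \<bullet> y) *\<^sub>R w - (x \<bullet> w) *\<^sub>R y"

lemma alternating3_inner: "alternating3 (\<lambda>x y w. (x \<odot> y) \<bullet> w)"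
  unfolding alternating3_def
  by (auto intro!: linearI simp: vp_linear inner_left_distrib inner_right_distrib
      vp_inner_left vp_inner_right)

lemma alternating3_coassociative: "alternating3 coassociative"
proof -
  have "x \<odot> (y \<odot> x) = (x \<bullet> x) *\<^sub>R y - (x \<bullet> y) *\<^sub>R x" for x y
    by (simp add: vp_anticommute[of y x] vp_linear vp_double)
  then show ?thesis
    unfolding alternating3_def coassociative_def
    by (auto intro!: linearI simp: vp_linear vp_double inner_left_distrib inner_right_distrib
        algebra_simps)
qed

lemma alternating3_coassociative_inner: "alternating3 (\<lambda>x y w. coassociative x y w \<bullet> l)"
  using alternating3_coassociative unfolding alternating3_def
  by (auto intro: linear_compose[OF _ bounded_linear.linear[OF bounded_linear_inner_left[of l]],
      unfolded o_def])

text \<open>For a three-dimensional space spanned by \<open>u\<close>, \<open>v\<close> and a combination of \<open>u \<odot> v\<close> and \<open>z\<close>, the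
  coassociative form singles out the line of \<open>(u \<odot> v) \<odot> z\<close> in the orthogonal complement.\<close>

lemma coassociative_cayley:
  assumes "cayley_triple (\<odot>) (u, v, z)"
  shows "coassociative u v (c *\<^sub>R (u \<odot> v) - s *\<^sub>R z) = s *\<^sub>R ((u \<odot> v) \<odot> z)"
  using cayley_tripleD[OF assms] cayley_products[OF assms]
  by (simp add: coassociative_def vp_linear inner_diff_right vp_inner_left vp_inner_left' vp_inner_right')

lemma rotated_cayley_invariants:
  fixes \<alpha> \<theta> :: real
  assumes "cayley_triple (\<odot>) s"
  defines "d \<equiv> rotate_frame \<alpha> \<theta> (cayley_basis (\<odot>) s)"
  shows "(d$1 \<odot> d$2) \<bullet> d$3 = cos \<alpha>" and "coassociative (d$1) (d$2) (d$3) \<bullet> d$7 = sin \<alpha> * cos \<theta>"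
proof -
  obtain u v z where s: "s = (u, v, z)" by (cases s) auto
  note t = assms(1)[unfolded s]
  have b: "cayley_basis (\<odot>) s $ i \<bullet> cayley_basis (\<odot>) s $ j = (if i = j then 1 else 0)" for i j
    using cayley_basis_orthonormal[OF assms(1)] by (rule orthonormal_frameD)
  show "(d$1 \<odot> d$2) \<bullet> d$3 = cos \<alpha>"
    using b[of 3 3] b[of 3 4] by (simp add: d_def s rotate_frame_def inner_diff_right)
  show "coassociative (d$1) (d$2) (d$3) \<bullet> d$7 = sin \<alpha> * cos \<theta>"
    using b[of 7 7] b[of 7 6]
    by (simp add: d_def s rotate_frame_def coassociative_cayley[OF t] inner_add_right)
qed

text \<open>The alternating forms \<open>(x \<odot> y) \<bullet> w\<close> and \<open>coassociative x y w \<bullet> l\<close>, for \<open>l\<close> a unit vector in the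
  \<open>lam\<close>-eigenspace, have absolute values on orthonormal bases of the \<open>\<mu>\<close>-eigenspace that depend on \<open>\<delta>\<close>
  alone. By the preceding evaluation these are \<open>cos \<alpha>\<close> and \<open>sin \<alpha> * cos \<theta>\<close>. The second determines \<open>\<theta>\<close>
  unless \<open>\<alpha> = 0\<close>, in which case the domain of the angles forces \<open>\<theta> = 0\<close>.\<close>

lemma angles_unique:
  assumes dim: "DIM('a) = 7" and lin: "linear \<delta>" and ne: "lam \<noteq> \<mu>" "lam \<noteq> \<nu>" "\<mu> \<noteq> \<nu>"
    and s: "cayley_triple (\<odot>) s" "cayley_triple (\<odot>) s'"
    and d: "eigenframe \<delta> (spectrum_7 lam \<mu> \<nu>) (rotate_frame \<alpha> \<theta> (cayley_basis (\<odot>) s))"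
    and d': "eigenframe \<delta> (spectrum_7 lam \<mu> \<nu>) (rotate_frame \<alpha>' \<theta>' (cayley_basis (\<odot>) s'))"
    and ang: "(\<alpha>, \<theta>) \<in> {0<..pi / 2} \<times> {0..pi / 2} \<union> {(0, 0)}"
      "(\<alpha>', \<theta>') \<in> {0<..pi / 2} \<times> {0..pi / 2} \<union> {(0, 0)}"
  shows "\<alpha> = \<alpha>' \<and> \<theta> = \<theta>'"
proof -
  let ?d = "rotate_frame \<alpha> \<theta> (cayley_basis (\<odot>) s)"
  let ?d' = "rotate_frame \<alpha>' \<theta>' (cayley_basis (\<odot>) s')"
  have bounds: "0 \<le> \<alpha>" "\<alpha> \<le> pi / 2" "0 \<le> \<alpha>'" "\<alpha>' \<le> pi / 2"
    "0 \<le> \<theta>" "\<theta> \<le> pi / 2" "0 \<le> \<theta>'" "\<theta>' \<le> pi / 2"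
    using ang by auto
  have pos: "0 \<le> cos x" if "0 \<le> x" "x \<le> pi / 2" for x
    using that by (intro cos_ge_zero) auto
  note eq = eigenframe_alternating3_eq[OF d d' lin dim ne(1,3)]
  note inv = rotated_cayley_invariants[OF s(1), of \<alpha> \<theta>] rotated_cayley_invariants[OF s(2), of \<alpha>' \<theta>']
  have "\<bar>cos \<alpha>\<bar> = \<bar>cos \<alpha>'\<bar>"
    using eq[OF alternating3_inner] by (simp only: inv)
  then have "cos \<alpha> = cos \<alpha>'" using pos[OF bounds(1,2)] pos[OF bounds(3,4)] by linarith
  then have \<alpha>: "\<alpha> = \<alpha>'" using bounds pi_gt_zero by - (rule cos_inj_pi, linarith+)
  have "?d' $ 7 = ?d $ 7 \<or> ?d' $ 7 = - ?d $ 7"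
    by (rule eigenframe_lam_line[OF d d' lin dim ne(1,2)])
  then have d7: "\<bar>x \<bullet> ?d $ 7\<bar> = \<bar>x \<bullet> ?d' $ 7\<bar>" for x by auto
  have "\<bar>sin \<alpha> * cos \<theta>\<bar> = \<bar>coassociative (?d $ 1) (?d $ 2) (?d $ 3) \<bullet> ?d $ 7\<bar>"
    by (simp only: inv)
  also have "\<dots> = \<bar>coassociative (?d $ 1) (?d $ 2) (?d $ 3) \<bullet> ?d' $ 7\<bar>"
    by (rule d7)
  also have "\<dots> = \<bar>coassociative (?d' $ 1) (?d' $ 2) (?d' $ 3) \<bullet> ?d' $ 7\<bar>"
    by (rule eq[OF alternating3_coassociative_inner])
  also have "\<dots> = \<bar>sin \<alpha>' * cos \<theta>'\<bar>"
    by (simp only: inv)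
  finally have "\<bar>sin \<alpha>\<bar> * cos \<theta> = \<bar>sin \<alpha>\<bar> * cos \<theta>'"
    using pos[OF bounds(5,6)] pos[OF bounds(7,8)] by (simp add: \<alpha> abs_mult)
  moreover have "\<alpha> = 0 \<or> sin \<alpha> \<noteq> 0"
    using bounds(1,2) sin_gt_zero[of \<alpha>] pi_gt_zero by fastforce
  ultimately have "\<alpha> = 0 \<or> cos \<theta> = cos \<theta>'" by auto
  then have "\<theta> = \<theta>'"
  proof
    assume "\<alpha> = 0"
    then show ?thesis using ang \<alpha> by auto
  next
    assume "cos \<theta> = cos \<theta>'"
    then show ?thesis using bounds pi_gt_zero by - (rule cos_inj_pi, linarith+)
  qed
  then show ?thesis using \<alpha> by simp
qed

section \<open>Every position is a rotated Cayley basis\<close>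

text \<open>The case \<open>\<alpha> = 0\<close>: the three-dimensional space is closed under \<open>\<odot>\<close>. Left multiplication by its third
  vector is a complex structure on the complement, so the equation \<open>(u \<odot> v) \<odot> z = l\<close> is solved by
  \<open>z = - (u \<odot> v) \<odot> l\<close>.\<close>

lemma associative_position:
  assumes on: "orthonormal_frame (e :: 'a ^ 3)" and e3: "e$3 = e$1 \<odot> e$2"
    and l: "l \<bullet> l = 1" "\<And>i. l \<bullet> e$i = 0"
  obtains z where "cayley_triple (\<odot>) (e$1, e$2, z)" "(e$1 \<odot> e$2) \<odot> z = l"
proof
  have e: "e$i \<bullet> e$j = (if i = j then 1 else 0)" for i j
    using on by (rule orthonormal_frameD)
  have le: "l \<bullet> e$1 = 0" "l \<bullet> e$2 = 0" "l \<bullet> e$3 = 0" using l(2) by auto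
  have "e$2 \<odot> (e$2 \<odot> e$1) = - e$1" by (simp add: vp_double e)
  then have prods: "e$1 \<odot> e$3 = - e$2" "e$2 \<odot> e$3 = e$1"
    by (simp_all add: e3 vp_double e vp_anticommute[of "e$2" "e$1"] vp_linear)
  show "cayley_triple (\<odot>) (e$1, e$2, - (e$3 \<odot> l))"
  proof (rule cayley_tripleI)
    show "e$1 \<bullet> - (e$3 \<odot> l) = 0" "e$2 \<bullet> - (e$3 \<odot> l) = 0"
      using vp_inner_cyclic[of "e$1" "e$3" l] vp_inner_cyclic[of "e$2" "e$3" l] le
      by (simp_all add: prods inner_commute)
    show "- (e$3 \<odot> l) \<bullet> - (e$3 \<odot> l) = 1"
      using l le e[of 3 3] by (simp add: vp_inner_self inner_commute)
  qed (simp_all add: e e3[symmetric] vp_inner_left vp_inner_left' vp_inner_right')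
  show "(e$1 \<odot> e$2) \<odot> - (e$3 \<odot> l) = l"
    using le e[of 3 3] by (simp add: e3[symmetric] vp_linear vp_double inner_commute)
qed

text \<open>The case \<open>sin \<alpha> \<noteq> 0\<close>. Let \<open>W\<close> be the span of \<open>e\<close> and let \<open>c\<close> be the unit vector of the complement singled out
  by the coassociative form, so that \<open>l\<close> is, up to sign, \<open>sin \<theta> *\<^sub>R p + cos \<theta> *\<^sub>R c\<close> with a unit vector \<open>p\<close>
  orthogonal to \<open>W\<close> and \<open>c\<close>. A triple \<open>(u, v, z)\<close> in the required position must satisfy
  \<open>(u \<odot> v) \<odot> z = c\<close> and \<open>v \<odot> z = p\<close>, hence \<open>u \<odot> c = p\<close>. Right multiplication by \<open>c\<close> maps \<open>W\<close>
  isometrically onto the vectors orthogonal to \<open>W\<close> and \<open>c\<close>, so this determines \<open>u\<close> in \<open>W\<close>; its coordinate vector is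
  \<open>r\<close>. Any completion of \<open>r\<close> to a positively oriented orthonormal basis of \<open>real ^ 3\<close> then works:
  the orientation keeps both alternating forms unchanged, which fixes the angle and the vector \<open>c\<close>.\<close>

lemma generic_position:
  assumes dim: "DIM('a) = 7"
    and on: "orthonormal_frame (e :: 'a ^ 3)"
    and e3: "e$3 = cos \<alpha> *\<^sub>R (e$1 \<odot> e$2) - sin \<alpha> *\<^sub>R z"
    and z: "cayley_triple (\<odot>) (e$1, e$2, z)" and \<alpha>: "sin \<alpha> \<noteq> 0"
    and l: "l \<bullet> l = 1" "\<And>i. l \<bullet> e$i = 0"
  obtains r s z' \<theta> where
    "cayley_triple (\<odot>) (combination e r, combination e s, z')"
    "cos \<alpha> *\<^sub>R (combination e r \<odot> combination e s) - sin \<alpha> *\<^sub>R z' = combination e (cross3 r s)"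
    "0 \<le> \<theta>" "\<theta> \<le> pi / 2"
    "sin \<theta> *\<^sub>R (combination e s \<odot> z') + cos \<theta> *\<^sub>R ((combination e r \<odot> combination e s) \<odot> z') \<in> {l, - l}"
proof -
  have DIM: "DIM('a) = CARD(7)" using dim by simp
  define w where "w = e$1 \<odot> e$2"
  define c where "c = w \<odot> z"
  define F where "F = rotate_frame \<alpha> 0 (cayley_basis (\<odot>) (e$1, e$2, z))"
  note p = cayley_products[OF z, folded w_def]
  have F: "orthonormal_frame F"
    unfolding F_def by (intro rotate_frame_orthonormal cayley_basis_orthonormal z)
  have Fk: "F$1 = e$1" "F$2 = e$2" "F$3 = e$3" "F$4 = sin \<alpha> *\<^sub>R w + cos \<alpha> *\<^sub>R z"
    "F$5 = e$1 \<odot> z" "F$6 = e$2 \<odot> z" "F$7 = c"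
    by (simp_all add: F_def rotate_frame_def e3 w_def c_def)
  \<comment> \<open>The sign of \<open>l\<close> is chosen so that \<open>\<theta>\<close> does not exceed a right angle.\<close>
  define l' where "l' = (if l \<bullet> c \<ge> 0 then l else - l)"
  have l': "l' \<bullet> l' = 1" "\<And>i. l' \<bullet> e$i = 0" "l' \<bullet> c \<ge> 0" "l' \<in> {l, - l}"
    using l by (auto simp: l'_def)
  \<comment> \<open>The coordinates of \<open>sin \<theta> *\<^sub>R u\<close>, obtained by inverting \<open>e$1 \<odot> c = F$6\<close>, \<open>e$2 \<odot> c = - F$5\<close>
    and \<open>e$3 \<odot> c = - F$4\<close>.\<close>
  define x :: "real^3" where "x = vector [l' \<bullet> F$6, - (l' \<bullet> F$5), - (l' \<bullet> F$4)]"
  have l'_eq: "l' = (l' \<bullet> F$4) *\<^sub>R F$4 + (l' \<bullet> F$5) *\<^sub>R F$5 + (l' \<bullet> F$6) *\<^sub>R F$6 + (l' \<bullet> c) *\<^sub>R c"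
    using frame_expand[OF F DIM, of l'] l'(2) by (simp add: sum_7 Fk(1-3,7))
  have "1 = (l' \<bullet> F$4)\<^sup>2 + (l' \<bullet> F$5)\<^sup>2 + (l' \<bullet> F$6)\<^sup>2 + (l' \<bullet> c)\<^sup>2"
    using arg_cong[OF l'_eq, of "\<lambda>y. l' \<bullet> y"] l'(1)
    by (simp add: inner_add_right power2_eq_square)
  also have "\<dots> = (norm x)\<^sup>2 + (l' \<bullet> c)\<^sup>2"
    unfolding x_def power2_norm_eq_inner by (simp add: inner_vec_def sum_3 power2_eq_square)
  finally have x: "(norm x)\<^sup>2 + (l' \<bullet> c)\<^sup>2 = 1" by simp
  define \<theta> where "\<theta> = arccos (l' \<bullet> c)"
  have "(l' \<bullet> c)\<^sup>2 \<le> 1\<^sup>2" using x zero_le_power2[of "norm x"] unfolding one_power2 by linarith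
  then have le1: "l' \<bullet> c \<le> 1" by (rule power2_le_imp_le) simp
  have \<theta>: "0 \<le> \<theta>" "\<theta> \<le> pi / 2" "cos \<theta> = l' \<bullet> c"
    using arccos_le_pi2[OF l'(3) le1] le1 l'(3) by (simp_all add: \<theta>_def arccos_lbound cos_arccos)
  have "sin \<theta> = norm x"
  proof (rule power2_eq_imp_eq)
    show "(sin \<theta>)\<^sup>2 = (norm x)\<^sup>2" using x \<theta>(3) by (simp add: sin_squared_eq)
    show "0 \<le> sin \<theta>" using \<theta> by (intro sin_ge_zero) auto
  qed simp
  \<comment> \<open>For \<open>x = 0\<close>, where \<open>l\<close> lies on the line of \<open>c\<close>, any unit vector will do.\<close>
  obtain r :: "real^3" where r: "norm r = 1" "x = sin \<theta> *\<^sub>R r"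
  proof (cases "x = 0")
    case True
    then show ?thesis using that[of "axis 1 1"] \<open>sin \<theta> = norm x\<close> by simp
  next
    case False
    then show ?thesis using that[of "x /\<^sub>R norm x"] \<open>sin \<theta> = norm x\<close> by simp
  qed
  have "2 \<le> DIM(real^3)" by simp
  then obtain y :: "real^3" where y: "y \<noteq> 0" "orthogonal r y"
    by (rule orthogonal_to_vector_exists)
  define s where "s = y /\<^sub>R norm y"
  have "norm s = 1" using y(1) by (simp add: s_def)
  then have rs: "r \<bullet> r = 1" "s \<bullet> s = 1" "r \<bullet> s = 0"
    using r(1) y(2) by (simp_all only: norm_eq_1) (simp add: s_def orthogonal_def)
  define t where "t = cross3 r s"
  have t: "t \<bullet> t = 1" "r \<bullet> t = 0" "s \<bullet> t = 0"
    using norm_cross[of r s] rs by (simp_all add: t_def dot_cross_self power2_norm_eq_inner)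
  define u v e' where "u = combination e r" "v = combination e s" "e' = combination e t"
  note uve = this
  have inn: "u \<bullet> u = 1" "v \<bullet> v = 1" "e' \<bullet> e' = 1" "u \<bullet> v = 0" "u \<bullet> e' = 0" "v \<bullet> e' = 0"
    using rs t by (simp_all add: uve combination_inner[OF on])
  have "(u \<odot> v) \<bullet> e' = (e$1 \<odot> e$2) \<bullet> e$3"
    using alternating3_combination[OF alternating3_inner, of e r s t] t(1) by (simp add: uve t_def)
  also have "\<dots> = cos \<alpha>"
    using rotated_cayley_invariants(1)[OF z, of \<alpha> 0, folded F_def] by (simp only: Fk)
  finally have phi: "(u \<odot> v) \<bullet> e' = cos \<alpha>" .
  define z' where "z' = (cos \<alpha> *\<^sub>R (u \<odot> v) - e') /\<^sub>R sin \<alpha>"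
  have uv: "(u \<odot> v) \<bullet> (u \<odot> v) = 1" using inn by (simp add: vp_inner_self)
  have "(cos \<alpha> *\<^sub>R (u \<odot> v) - e') \<bullet> (cos \<alpha> *\<^sub>R (u \<odot> v) - e') = (sin \<alpha>)\<^sup>2"
    unfolding inner_diff_left inner_diff_right inner_commute[of e' "_ *\<^sub>R (u \<odot> v)"]
    by (simp add: phi uv inn(3) sin_squared_eq flip: power2_eq_square)
  then have z'1: "z' \<bullet> z' = 1"
    unfolding z'_def inner_scaleR_left inner_scaleR_right
    using \<alpha> by (simp add: power2_eq_square field_simps)
  have cay: "cayley_triple (\<odot>) (u, v, z')"
  proof (rule cayley_tripleI)
    show "(u \<odot> v) \<bullet> z' = 0"
      using phi uv by (simp add: z'_def inner_diff_right)
  qed (use inn z'1 in \<open>simp_all add: z'_def inner_diff_right vp_inner_left' vp_inner_right'\<close>)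
  have e': "cos \<alpha> *\<^sub>R (u \<odot> v) - sin \<alpha> *\<^sub>R z' = e'"
    using \<alpha> by (simp add: z'_def)
  have "sin \<alpha> *\<^sub>R ((u \<odot> v) \<odot> z') = coassociative u v e'"
    unfolding e'[symmetric] by (rule coassociative_cayley[OF cay, symmetric])
  also have "\<dots> = coassociative (e$1) (e$2) (e$3)"
    using alternating3_combination[OF alternating3_coassociative, of e r s t] t(1) by (simp add: uve t_def)
  also have "\<dots> = sin \<alpha> *\<^sub>R c"
    unfolding e3 c_def w_def by (rule coassociative_cayley[OF z])
  finally have c: "(u \<odot> v) \<odot> z' = c" using \<alpha> by simp
  have "v \<odot> z' = u \<odot> c"
    using cayley_products(11)[OF cay] c by simp
  also have "\<dots> = r$1 *\<^sub>R F$6 - r$2 *\<^sub>R F$5 - r$3 *\<^sub>R F$4"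
  proof -
    have "e$3 \<odot> c = - F$4"
      unfolding e3 w_def[symmetric] Fk c_def using p by (simp add: vp_linear)
    moreover have "e$1 \<odot> c = F$6" "e$2 \<odot> c = - F$5"
      using p by (simp_all add: c_def Fk)
    ultimately show ?thesis by (simp add: uve combination_def vp_linear)
  qed
  finally have vz: "v \<odot> z' = r$1 *\<^sub>R F$6 - r$2 *\<^sub>R F$5 - r$3 *\<^sub>R F$4" .
  have "sin \<theta> * r$1 = l' \<bullet> F$6" "sin \<theta> * r$2 = - (l' \<bullet> F$5)" "sin \<theta> * r$3 = - (l' \<bullet> F$4)"
    using r(2) by (simp_all add: x_def vec_eq_iff forall_3)
  then have "sin \<theta> *\<^sub>R (v \<odot> z') + cos \<theta> *\<^sub>R ((u \<odot> v) \<odot> z') = l'"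
    by (subst l'_eq) (simp add: vz c \<theta>(3) scaleR_diff_right)
  then show ?thesis
    using that[of r s z' \<theta>] cay e' \<theta> l'(4) by (simp add: uve t_def)
qed

lemma normal_position:
  assumes dim: "DIM('a) = 7" and S: "subspace S"
    and e: "orthonormal_frame (e :: 'a ^ 3)" "\<And>i. e$i \<in> S"
    and l: "l \<bullet> l = 1" "\<And>i. l \<bullet> e$i = 0"
  obtains u v z \<alpha> \<theta> where
    "cayley_triple (\<odot>) (u, v, z)"
    "(\<alpha>, \<theta>) \<in> {0<..pi / 2} \<times> {0..pi / 2} \<union> {(0, 0)}"
    "u \<in> S" "v \<in> S" "cos \<alpha> *\<^sub>R (u \<odot> v) - sin \<alpha> *\<^sub>R z \<in> S"
    "sin \<theta> *\<^sub>R (v \<odot> z) + cos \<theta> *\<^sub>R ((u \<odot> v) \<odot> z) \<in> {l, - l}"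
proof -
  \<comment> \<open>Reversing \<open>e$3\<close> if necessary makes \<open>cos \<alpha>\<close> nonnegative without changing the span.\<close>
  define f :: "'a ^ 3" where
    "f = vector [e$1, e$2, if (e$1 \<odot> e$2) \<bullet> e$3 \<ge> 0 then e$3 else - e$3]"
  have f: "orthonormal_frame f" "\<And>i. f$i \<in> S" "\<And>i. l \<bullet> f$i = 0"
  proof -
    show "orthonormal_frame f"
      using orthonormal_frameD[OF e(1)] by (simp add: orthonormal_frame_def forall_3 f_def)
    have "\<forall>i. f$i \<in> S" "\<forall>i. l \<bullet> f$i = 0"
      using e(2) S l(2) by (simp_all add: forall_3 f_def subspace_neg)
    then show "\<And>i. f$i \<in> S" "\<And>i. l \<bullet> f$i = 0" by auto
  qed
  have phi: "(f$1 \<odot> f$2) \<bullet> f$3 \<ge> 0" by (simp add: f_def)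
  have ff: "f$i \<bullet> f$j = (if i = j then 1 else 0)" for i j
    using f(1) by (rule orthonormal_frameD)
  define w where "w = f$1 \<odot> f$2"
  have w: "w \<bullet> w = 1" by (simp add: w_def vp_inner_self ff)
  define \<alpha> where "\<alpha> = arccos (w \<bullet> f$3)"
  have w3: "0 \<le> w \<bullet> f$3" using phi by (simp add: w_def)
  have le1: "w \<bullet> f$3 \<le> 1"
    using Cauchy_Schwarz_ineq2[of w "f$3"] w ff[of 3 3] by (simp flip: norm_eq_1)
  have \<alpha>: "0 \<le> \<alpha>" "\<alpha> \<le> pi / 2" "cos \<alpha> = w \<bullet> f$3"
    using arccos_le_pi2[OF w3 le1] le1 w3 by (simp_all add: \<alpha>_def arccos_lbound cos_arccos)
  have comb: "combination f r \<in> S" for r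
    using f(2) S by (simp add: combination_def subspace_add subspace_scale)
  show ?thesis
  proof (cases "\<alpha> = 0")
    case True
    have "(w - f$3) \<bullet> (w - f$3) = 0"
      using True \<alpha>(3) w ff[of 3 3] by (simp add: inner_diff_left inner_diff_right inner_commute)
    then have "f$3 = f$1 \<odot> f$2" by (simp add: w_def)
    then obtain z where z: "cayley_triple (\<odot>) (f$1, f$2, z)" "(f$1 \<odot> f$2) \<odot> z = l"
      using associative_position[OF f(1) _ l(1) f(3)] by blast
    show ?thesis
      by (rule that[OF z(1), of 0 0]) (use f(2) z(2) \<open>f$3 = _\<close>[symmetric] in auto)
  next
    case False
    then have "0 < \<alpha>" using \<alpha> by simp
    then have sin: "sin \<alpha> > 0" using \<alpha> by (intro sin_gt_zero) auto
    define z where "z = (cos \<alpha> *\<^sub>R w - f$3) /\<^sub>R sin \<alpha>"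
    have f3: "f$3 = cos \<alpha> *\<^sub>R (f$1 \<odot> f$2) - sin \<alpha> *\<^sub>R z"
      using sin by (simp add: z_def w_def)
    have "(cos \<alpha> *\<^sub>R w - f$3) \<bullet> (cos \<alpha> *\<^sub>R w - f$3) = (sin \<alpha>)\<^sup>2"
      unfolding inner_diff_left inner_diff_right inner_commute[of "f$3" "_ *\<^sub>R w"]
      by (simp add: \<alpha>(3)[symmetric] w ff sin_squared_eq flip: power2_eq_square)
    then have z1: "z \<bullet> z = 1"
      unfolding z_def inner_scaleR_left inner_scaleR_right
      using sin by (simp add: power2_eq_square field_simps)
    have z: "cayley_triple (\<odot>) (f$1, f$2, z)"
    proof (rule cayley_tripleI)
      show "(f$1 \<odot> f$2) \<bullet> z = 0"
        using \<alpha>(3) w by (simp add: z_def inner_diff_right flip: w_def)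
    qed (use z1 in \<open>simp_all add: ff z_def w_def inner_diff_right vp_inner_left' vp_inner_right'\<close>)
    from sin have "sin \<alpha> \<noteq> 0" by simp
    from generic_position[OF dim f(1) f3 z this l(1) f(3)]
    obtain r s z' \<theta> where *:
      "cayley_triple (\<odot>) (combination f r, combination f s, z')"
      "cos \<alpha> *\<^sub>R (combination f r \<odot> combination f s) - sin \<alpha> *\<^sub>R z' = combination f (cross3 r s)"
      "0 \<le> \<theta>" "\<theta> \<le> pi / 2"
      "sin \<theta> *\<^sub>R (combination f s \<odot> z') + cos \<theta> *\<^sub>R ((combination f r \<odot> combination f s) \<odot> z') \<in> {l, - l}"
      by blast
    show ?thesis
      by (rule that[OF *(1) _ _ _ _ *(5), of \<alpha>]) (use * \<alpha> \<open>0 < \<alpha>\<close> comb in auto)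
  qed
qed

lemma angles_exist:
  assumes dim: "DIM('a) = 7" and lin: "linear \<delta>" and ne: "lam \<noteq> \<mu>" "lam \<noteq> \<nu>" "\<mu> \<noteq> \<nu>"
    and D: "eigenframe \<delta> (spectrum_7 lam \<mu> \<nu>) D"
  obtains s \<alpha> \<theta> where "cayley_triple (\<odot>) s"
    "(\<alpha>, \<theta>) \<in> {0<..pi / 2} \<times> {0..pi / 2} \<union> {(0, 0)}"
    "eigenframe \<delta> (spectrum_7 lam \<mu> \<nu>) (rotate_frame \<alpha> \<theta> (cayley_basis (\<odot>) s))"
proof -
  define S where "S = {x. \<delta> x = \<mu> *\<^sub>R x}"
  have S: "subspace S"
    using lin by (auto simp: S_def subspace_def linear_add linear_scale linear_0 algebra_simps)
  have on: "orthonormal_frame D" and ev: "\<And>k. \<delta> (D$k) = spectrum_7 lam \<mu> \<nu> $ k *\<^sub>R D$k"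
    using D by (auto simp: eigenframe_def)
  define e :: "'a^3" where "e = vector [D$1, D$2, D$3]"
  have e: "orthonormal_frame e" "\<forall>i. e$i \<in> S" "\<forall>i. D$7 \<bullet> e$i = 0"
    using orthonormal_frameD[OF on] ev
    by (simp_all add: orthonormal_frame_def forall_3 e_def S_def spectrum_7_def)
  have D7: "D$7 \<bullet> D$7 = 1" using orthonormal_frameD[OF on, of 7 7] by simp
  obtain u v z \<alpha> \<theta> where *:
    "cayley_triple (\<odot>) (u, v, z)" "(\<alpha>, \<theta>) \<in> {0<..pi / 2} \<times> {0..pi / 2} \<union> {(0, 0)}"
    "u \<in> S" "v \<in> S" "cos \<alpha> *\<^sub>R (u \<odot> v) - sin \<alpha> *\<^sub>R z \<in> S"
    "sin \<theta> *\<^sub>R (v \<odot> z) + cos \<theta> *\<^sub>R ((u \<odot> v) \<odot> z) \<in> {D$7, - D$7}"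
    by (rule normal_position[OF dim S e(1) spec[OF e(2)] D7 spec[OF e(3)]])
  have lam: "\<delta> x = lam *\<^sub>R x" if "x \<in> {D$7, - D$7}" for x
    using that ev[of 7] by (auto simp: linear_neg[OF lin] spectrum_7_def)
  have "eigenframe \<delta> (spectrum_7 lam \<mu> \<nu>) (rotate_frame \<alpha> \<theta> (cayley_basis (\<odot>) (u, v, z)))"
    by (rule eigenframe_complete[OF D rotate_frame_orthonormal[OF cayley_basis_orthonormal[OF *(1)]]
          lin dim ne])
       (use * lam in \<open>simp_all add: rotate_frame_def S_def\<close>)
  then show ?thesis by (rule that[OF *(1,2)])
qed

end

section \<open>The cross-section\<close>

theorem proposition3p6:
  fixes \<pi> :: "'a::euclidean_space \<Rightarrow> 'a \<Rightarrow> 'a"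
    and s :: "'a \<times> 'a \<times> 'a"
    and lam \<mu> \<nu> :: real
  assumes "DIM('a) = 7"
    and "vector_product \<pi>"
    and "cayley_triple \<pi> s"
    and "lam \<noteq> \<mu>" and "lam \<noteq> \<nu>" and "\<mu> \<noteq> \<nu>"
  shows "cross_section \<pi> s (Sym_with {(lam, 1), (\<mu>, 3), (\<nu>, 3)})
    {block_diag (\<mu> *\<^sub>R mat 1) (rotated_diag \<alpha> \<mu> \<nu>) \<nu> (rotated_diag \<theta> \<nu> lam) | \<alpha> \<theta>.
       (\<alpha>, \<theta>) \<in> {0<..pi / 2} \<times> {0..pi / 2} \<union> {(0, 0)}}"
proof -
  interpret vector_product_space \<pi> by standard fact
  let ?X = "Sym_with {(lam, 1), (\<mu>, 3), (\<nu>, 3)}"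
  let ?A = "{0<..pi / 2} \<times> {0..pi / 2} \<union> {(0, 0)} :: (real \<times> real) set"
  let ?C = "{normal_form lam \<mu> \<nu> \<alpha> \<theta> | \<alpha> \<theta>. (\<alpha>, \<theta>) \<in> ?A}"
  note ne = assms(4-6)
  have sub: "?C \<subseteq> ?X" using normal_form_Sym_with[OF ne] by blast
  have ex1: "\<exists>!N. N \<in> ?C \<and> N \<in> orbit \<pi> s M" if M: "M \<in> ?X" for M
  proof -
    define \<delta> where "\<delta> = endo_of \<pi> s M"
    have sym: "M \<in> symmetric_matrices" using M by (simp add: Sym_with_def)
    have lin: "linear \<delta>"
      using endo_of(1)[OF assms(1,3) sym] by (simp add: \<delta>_def symmetric_endos_def)
    have orbit: "orbit \<pi> s M = {matrix_wrt \<pi> t \<delta> | t. cayley_triple \<pi> t}"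
      unfolding \<delta>_def by (rule orbit_eq_matrix_wrt[OF assms(1,3)])
    have normal: "matrix_wrt \<pi> t \<delta> = normal_form lam \<mu> \<nu> \<alpha> \<theta> \<longleftrightarrow>
        eigenframe \<delta> (spectrum_7 lam \<mu> \<nu>) (rotate_frame \<alpha> \<theta> (cayley_basis \<pi> t))"
      if "cayley_triple \<pi> t" for t \<alpha> \<theta>
      unfolding matrix_wrt_def
      by (rule normal_form_eigenframe_iff[OF cayley_basis_orthonormal[OF that] assms(1) lin])
    obtain d where "eigenframe ((*v) M) (spectrum_7 lam \<mu> \<nu>) d"
      using Sym_with_eigenframe[OF M ne] .
    then obtain D where D: "eigenframe \<delta> (spectrum_7 lam \<mu> \<nu>) D"
      unfolding \<delta>_def using endo_of_eigenframe[OF assms(1,3) sym] by blast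
    show ?thesis
    proof (rule ex_ex1I)
      show "\<exists>N. N \<in> ?C \<and> N \<in> orbit \<pi> s M"
      proof -
        obtain t \<alpha> \<theta> where t: "cayley_triple \<pi> t" "(\<alpha>, \<theta>) \<in> ?A"
          "eigenframe \<delta> (spectrum_7 lam \<mu> \<nu>) (rotate_frame \<alpha> \<theta> (cayley_basis \<pi> t))"
          using angles_exist[OF assms(1) lin ne D] .
        then have "matrix_wrt \<pi> t \<delta> = normal_form lam \<mu> \<nu> \<alpha> \<theta>" using normal by blast
        then show ?thesis using t(1,2) unfolding orbit by blast
      qed
    next
      fix N N' assume N: "N \<in> ?C \<and> N \<in> orbit \<pi> s M" and N': "N' \<in> ?C \<and> N' \<in> orbit \<pi> s M"
      obtain t \<alpha> \<theta> where t: "cayley_triple \<pi> t" "(\<alpha>, \<theta>) \<in> ?A"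
        "N = normal_form lam \<mu> \<nu> \<alpha> \<theta>" "N = matrix_wrt \<pi> t \<delta>"
        using N unfolding orbit by blast
      obtain t' \<alpha>' \<theta>' where t': "cayley_triple \<pi> t'" "(\<alpha>', \<theta>') \<in> ?A"
        "N' = normal_form lam \<mu> \<nu> \<alpha>' \<theta>'" "N' = matrix_wrt \<pi> t' \<delta>"
        using N' unfolding orbit by blast
      have "\<alpha> = \<alpha>' \<and> \<theta> = \<theta>'"
        using t t' normal[OF t(1), of \<alpha> \<theta>] normal[OF t'(1), of \<alpha>' \<theta>']
        by (intro angles_unique[OF assms(1) lin ne t(1) t'(1) _ _ t(2) t'(2)]) simp_all
      then show "N = N'" using t(3) t'(3) by simp
    qed
  qed
  show ?thesis
    unfolding cross_section_def normal_form_def[symmetric]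
  proof (intro conjI ballI)
    show "?C \<subseteq> ?X" by (rule sub)
    fix Orb assume "Orb \<in> orbit \<pi> s ` ?X"
    then obtain M where M: "Orb = orbit \<pi> s M" "M \<in> ?X" by (rule imageE)
    show "\<exists>!N. N \<in> ?C \<and> N \<in> Orb" unfolding M(1) by (rule ex1[OF M(2)])
  qed
qed

end
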